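(* Let $\mathcal X\subseteq\operatorname{Aut}(\mathcal B_\omega)$ be the set of all $f\in\operatorname{Aut}(\mathcal B_\omega)$ such that the permutation $\tau_f$ has no finite cycles. Then: (i) the set $$\{(f,g)\in\mathcal X\times\operatorname{Aut}(\mathcal B_\omega): f\text{ and }g\text{ freely generate a dense subgroup of }\operatorname{Aut}(\mathcal B_\omega)\}$$ is comeager in $\mathcal X\times\operatorname{Aut}(\mathcal B_\omega)$; (ii) for every natural number $m\ge1$, the set of cyclically dense elements $\bar g\in\operatorname{Aut}(\mathcal B_\omega)^m$ for the diagonal action is comeager in $\operatorname{Aut}(\mathcal B_\omega)^m$.
   Context: $\mathbb N=\{1,2,3,\dots\}$. $\mathcal B_\omega$ is the poset with underlying set $\mathbb N\times\mathbb Q$ and order $(k,p)\le(l,q)\iff k=l$ and $p\le q$. Every $f\in\operatorname{Aut}(\mathcal B_\omega)$ has the form $f(k,p)=(\tau_f(k),f_k(p))$ for a unique permutation $\tau_f$ of $\mathbb N$ and $f_k\in\operatorname{Aut}(\mathbb Q,\le)$. "$\tau_f$ has no finite cycles" means that $\{\tau_f^k(n):k\ge 0\}$ is infinite for each $n\in\mathbb N$. $\operatorname{Aut}(\mathcal B_\omega)$ carries the topology with basic open sets $\{\bar f: f\subset\bar f\}$, $f$ an isomorphism between finite subposets; products and subspaces have the product and subspace topologies. For a topological group $G$, $\bar g=(g_1,\dots,g_m)\in G^m$ is cyclically dense for the diagonal action of $G$ on $G^m$ if for some $f\in G$ the set $\{(f^kg_1f^{-k},\dots,f^kg_mf^{-k}):k\in\mathbb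 Z\}$ is dense in $G^m$. Comeager means complement of a countable union of nowhere dense sets. "$f$ and $g$ freely generate a dense subgroup" means that $w(f,g)\ne\operatorname{id}$ for every irreducible word $w(a,b)$ (an expression $c_1^{n_1}\cdots c_k^{n_k}$, $k\ge1$, $c_i\in\{a,b\}$, $n_i\in\mathbb Z\setminus\{0\}$, $c_i\neq c_{i+1}$) and $\langle f,g\rangle$ is dense. *)

theory Defs
  imports "HOL-Analysis.Analysis" "HOL-Algebra.Generated_Groups" "HOL-Combinatorics.Permutations"
begin

section \<open>Automorphism groups of posets\<close>

text \<open>
  A poset is a carrier \<open>S\<close> with a relation \<open>r\<close>. Self-bijections of \<open>S\<close> are represented by
  total functions that fix every point outside \<open>S\<close> (\<^const>\<open>permutes\<close>), so that the group
  operations are plain composition and inversion of functions.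
\<close>

definition order_preserving_reflecting_on ::
    "'a set \<Rightarrow> ('a \<Rightarrow> 'a \<Rightarrow> bool) \<Rightarrow> ('a \<Rightarrow> 'a) \<Rightarrow> bool" where
  "order_preserving_reflecting_on A r f \<longleftrightarrow> (\<forall>x\<in>A. \<forall>y\<in>A. r x y \<longleftrightarrow> r (f x) (f y))"

definition order_auts :: "'a set \<Rightarrow> ('a \<Rightarrow> 'a \<Rightarrow> bool) \<Rightarrow> ('a \<Rightarrow> 'a) set" where
  "order_auts S r = {f. f permutes S \<and> order_preserving_reflecting_on S r f}"

definition aut_group :: "'a set \<Rightarrow> ('a \<Rightarrow> 'a \<Rightarrow> bool) \<Rightarrow> ('a \<Rightarrow> 'a) monoid" where
  "aut_group S r = \<lparr>carrier = order_auts S r, mult = (\<circ>), one = id\<rparr>"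

text \<open>\<open>p\<close> restricted to \<open>A\<close> is an isomorphism between the finite subposets \<open>A\<close> and \<open>A'\<close> of \<open>S\<close>.\<close>

definition finite_partial_iso ::
    "'a set \<Rightarrow> ('a \<Rightarrow> 'a \<Rightarrow> bool) \<Rightarrow> 'a set \<Rightarrow> 'a set \<Rightarrow> ('a \<Rightarrow> 'a) \<Rightarrow> bool" where
  "finite_partial_iso S r A A' p \<longleftrightarrow>
     finite A \<and> A \<subseteq> S \<and> A' \<subseteq> S \<and> bij_betw p A A' \<and> order_preserving_reflecting_on A r p"

definition aut_topology :: "'a set \<Rightarrow> ('a \<Rightarrow> 'a \<Rightarrow> bool) \<Rightarrow> ('a \<Rightarrow> 'a) topology" where
  "aut_topology S r = topology_generated_by
     {{h \<in> order_auts S r. \<forall>x\<in>A. h x = p x} | A A' p. finite_partial_iso S r A A' p}"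


section \<open>The poset \<open>B_\<omega>\<close>\<close>

definition Bw :: "(nat \<times> rat) set" where
  "Bw = {1..} \<times> UNIV"

text \<open>This differs from the componentwise order on pairs.\<close>

definition Bw_le :: "nat \<times> rat \<Rightarrow> nat \<times> rat \<Rightarrow> bool" where
  "Bw_le x y \<longleftrightarrow> fst x = fst y \<and> snd x \<le> snd y"

abbreviation AutB :: "(nat \<times> rat \<Rightarrow> nat \<times> rat) monoid" where
  "AutB \<equiv> aut_group Bw Bw_le"

abbreviation AutB_top :: "(nat \<times> rat \<Rightarrow> nat \<times> rat) topology" where
  "AutB_top \<equiv> aut_topology Bw Bw_le"

definition is_tau :: "(nat \<times> rat \<Rightarrow> nat \<times> rat) \<Rightarrow> (nat \<Rightarrow> nat) \<Rightarrow> bool" where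
  "is_tau f t \<longleftrightarrow> t permutes {1..} \<and>
     (\<exists>h. \<forall>k\<ge>1. h k \<in> order_auts (UNIV :: rat set) (\<le>) \<and> (\<forall>p. f (k, p) = (t k, h k p)))"

definition tau :: "(nat \<times> rat \<Rightarrow> nat \<times> rat) \<Rightarrow> nat \<Rightarrow> nat" where
  "tau f = (THE t. is_tau f t)"

definition no_finite_cycles :: "(nat \<Rightarrow> nat) \<Rightarrow> bool" where
  "no_finite_cycles t \<longleftrightarrow> (\<forall>n\<ge>1. infinite {(t ^^ k) n | k. True})"

definition XB :: "(nat \<times> rat \<Rightarrow> nat \<times> rat) set" where
  "XB = {f \<in> carrier AutB. no_finite_cycles (tau f)}"


section \<open>Baire category\<close>

definition dense_in :: "'a topology \<Rightarrow> 'a set \<Rightarrow> bool" where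
  "dense_in T D \<longleftrightarrow> D \<subseteq> topspace T \<and> T closure_of D = topspace T"

definition nowhere_dense_in :: "'a topology \<Rightarrow> 'a set \<Rightarrow> bool" where
  "nowhere_dense_in T A \<longleftrightarrow> A \<subseteq> topspace T \<and> T interior_of (T closure_of A) = {}"

definition comeager_in :: "'a topology \<Rightarrow> 'a set \<Rightarrow> bool" where
  "comeager_in T C \<longleftrightarrow> C \<subseteq> topspace T \<and>
     (\<exists>\<N>. countable \<N> \<and> (\<forall>A\<in>\<N>. nowhere_dense_in T A) \<and> topspace T - C = \<Union>\<N>)"


section \<open>Free generation and cyclic density\<close>

datatype letter = Letter_a | Letter_b

definition irreducible_word :: "(letter \<times> int) list \<Rightarrow> bool" where
  "irreducible_word w \<longleftrightarrow> w \<noteq> [] \<and> (\<forall>(c, n)\<in>set w. n \<noteq> 0) \<and> distinct_adj (map fst w)"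

definition word_eval ::
    "('g, 'm) monoid_scheme \<Rightarrow> 'g \<Rightarrow> 'g \<Rightarrow> (letter \<times> int) list \<Rightarrow> 'g" where
  "word_eval G f g w =
     foldr (\<lambda>(c, n) x. (case c of Letter_a \<Rightarrow> f | Letter_b \<Rightarrow> g) [^]\<^bsub>G\<^esub> n \<otimes>\<^bsub>G\<^esub> x) w \<one>\<^bsub>G\<^esub>"

definition freely_generate_dense ::
    "('g, 'm) monoid_scheme \<Rightarrow> 'g topology \<Rightarrow> 'g \<Rightarrow> 'g \<Rightarrow> bool" where
  "freely_generate_dense G T f g \<longleftrightarrow>
     (\<forall>w. irreducible_word w \<longrightarrow> word_eval G f g w \<noteq> \<one>\<^bsub>G\<^esub>) \<and> dense_in T (generate G {f, g})"

text \<open>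
  The power \<open>G\<^sup>m\<close> consists of the extensional functions on \<open>{1..m}\<close>, as in \<^const>\<open>product_topology\<close>.
\<close>

definition cyclically_dense ::
    "('g, 'm) monoid_scheme \<Rightarrow> 'g topology \<Rightarrow> nat \<Rightarrow> (nat \<Rightarrow> 'g) \<Rightarrow> bool" where
  "cyclically_dense G T m g \<longleftrightarrow> g \<in> {1..m} \<rightarrow>\<^sub>E carrier G \<and>
     (\<exists>f\<in>carrier G. dense_in (product_topology (\<lambda>_. T) {1..m})
        {\<lambda>i\<in>{1..m}. f [^]\<^bsub>G\<^esub> k \<otimes>\<^bsub>G\<^esub> g i \<otimes>\<^bsub>G\<^esub> f [^]\<^bsub>G\<^esub> (- k) | k :: int. True})"

end

theory Submission
  imports Defs
begin

text \<open>
  An automorphism of \<open>B_\<omega>\<close> permutes the columns \<open>{k} \<times> \<rat>\<close> through \<^const>\<open>tau\<close>, and any column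
  permutation together with order automorphisms of the single columns is allowed. If two
  automorphisms are prescribed on two disjoint finite sets of columns, and if also their
  image columns are disjoint, then one automorphism follows both prescriptions, because a finite
  injection of columns extends to a permutation (\<open>AutB_glue\<close>).

  Let \<open>\<tau>\<^sub>f\<close> have no finite cycles. Some power of \<open>\<tau>\<^sub>f\<close> moves a given finite set of columns off
  itself, so that conditions on finitely many values of \<open>g\<close> and of \<open>f\<^sup>k g f\<^sup>-\<^sup>k\<close> concern disjoint
  columns and can be met together for a suitable \<open>k\<close> (\<open>conj_pow_amalgamation\<close>). This holds for
  tuples as well, with the same \<open>k\<close> for all entries. A nonempty basic open set is given by
  finitely many values, and there are countably many such sets. For each of them,
  that it contains some conjugate \<open>f\<^sup>k g f\<^sup>-\<^sup>k\<close> is therefore an open dense condition on \<open>g\<close> for fixed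
  \<open>f\<close>, and on the pair \<open>(f, g)\<close> as well. Generically the conjugates \<open>f\<^sup>k g f\<^sup>-\<^sup>k\<close> are then
  dense. For a fixed \<open>f\<close> this is the statement on cyclic density, and it gives the density of
  the subgroup generated by \<open>f\<close> and \<open>g\<close>.

  Freeness follows from the density of the conjugates too. If \<open>w(f, g) = 1\<close>, conjugation by \<open>f\<^sup>k\<close> gives
  \<open>w(f, f\<^sup>k g f\<^sup>-\<^sup>k) = 1\<close>, and by continuity \<open>w(f, h) = 1\<close> for every \<open>h\<close>
  (\<open>dense_conjugates_no_relation\<close>). No irreducible word \<open>w\<close> is such a law: a column
  permutation \<open>s\<close> with \<open>w(\<tau>\<^sub>f, s) \<noteq> 1\<close> is found by following a column through the word, letting
  \<open>s\<close> act on columns not met before whenever a power of the second letter is applied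
  (\<open>word_walk_exists\<close>).
\<close>

section \<open>Automorphism groups and pointwise convergence\<close>

lemma carrier_aut_group [simp]: "carrier (aut_group S r) = order_auts S r"
  and mult_aut_group [simp]: "f \<otimes>\<^bsub>aut_group S r\<^esub> g = f \<circ> g"
  and one_aut_group [simp]: "\<one>\<^bsub>aut_group S r\<^esub> = id"
  by (simp_all add: aut_group_def)

lemma order_auts_permutes: "f \<in> order_auts S r \<Longrightarrow> f permutes S"
  by (simp add: order_auts_def)

lemma order_auts_in: "f \<in> order_auts S r \<Longrightarrow> x \<in> S \<Longrightarrow> f x \<in> S"
  by (metis order_auts_permutes permutes_in_image)

lemma order_auts_iff: "f \<in> order_auts S r \<Longrightarrow> x \<in> S \<Longrightarrow> y \<in> S \<Longrightarrow> r (f x) (f y) \<longleftrightarrow> r x y"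
  by (simp add: order_auts_def order_preserving_reflecting_on_def)

lemma order_auts_comp:
  assumes "f \<in> order_auts S r" "g \<in> order_auts S r" shows "f \<circ> g \<in> order_auts S r"
  using assms order_auts_in[OF assms(2)]
  by (auto simp: order_auts_def order_preserving_reflecting_on_def intro: permutes_compose)

lemma order_auts_inv:
  assumes "f \<in> order_auts S r" shows "inv_into UNIV f \<in> order_auts S r"
proof -
  have p: "f permutes S" using assms by (rule order_auts_permutes)
  have q: "inv_into UNIV f permutes S" using p by (rule permutes_inv)
  have "r x y \<longleftrightarrow> r (inv_into UNIV f x) (inv_into UNIV f y)" if "x \<in> S" "y \<in> S" for x y
    using order_auts_iff[OF assms, of "inv_into UNIV f x" "inv_into UNIV f y"] that
      permutes_in_image[OF q] permutes_inverses(1)[OF p] by simp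
  then show ?thesis
    using q by (simp add: order_auts_def order_preserving_reflecting_on_def)
qed

lemma group_aut_group: "group (aut_group S r)"
proof (rule groupI)
  show "\<one>\<^bsub>aut_group S r\<^esub> \<in> carrier (aut_group S r)"
    by (simp add: order_auts_def order_preserving_reflecting_on_def permutes_id)
  fix f assume "f \<in> carrier (aut_group S r)"
  then show "\<exists>g\<in>carrier (aut_group S r). g \<otimes>\<^bsub>aut_group S r\<^esub> f = \<one>\<^bsub>aut_group S r\<^esub>"
    using order_auts_inv[of f S r] permutes_inv_o(2)[OF order_auts_permutes, of f S r] by auto
qed (auto simp: order_auts_comp comp_assoc)

lemma aut_group_inv:
  assumes "f \<in> order_auts S r" shows "inv\<^bsub>aut_group S r\<^esub> f = inv_into UNIV f"
  by (rule group.inv_equality[OF group_aut_group])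
    (use assms order_auts_inv permutes_inv_o(2)[OF order_auts_permutes[OF assms]] in auto)

lemma aut_int_pow_in:
  "f \<in> order_auts S r \<Longrightarrow> f [^]\<^bsub>aut_group S r\<^esub> (n::int) \<in> order_auts S r"
  using group.int_pow_closed[OF group_aut_group, of f S r n] by simp

lemma aut_int_pow_add:
  assumes "f \<in> order_auts S r"
  shows "(f [^]\<^bsub>aut_group S r\<^esub> (m + n :: int)) x
       = (f [^]\<^bsub>aut_group S r\<^esub> m) ((f [^]\<^bsub>aut_group S r\<^esub> n) x)"
  using group.int_pow_mult[OF group_aut_group, of f S r m n] assms by simp

lemma aut_int_pow_neg_cancel:
  assumes "f \<in> order_auts S r"
  shows "(f [^]\<^bsub>aut_group S r\<^esub> (- n :: int)) ((f [^]\<^bsub>aut_group S r\<^esub> n) x) = x"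
    and "(f [^]\<^bsub>aut_group S r\<^esub> n) ((f [^]\<^bsub>aut_group S r\<^esub> (- n)) x) = x"
  using aut_int_pow_add[OF assms, of "- n" n x] aut_int_pow_add[OF assms, of n "- n" x] by simp_all

lemma topspace_aut_topology [simp]: "topspace (aut_topology S r) = order_auts S r"
proof -
  have "order_auts S r \<in> {{h \<in> order_auts S r. \<forall>x\<in>A. h x = p x} | A A' p. finite_partial_iso S r A A' p}"
    by (auto simp: finite_partial_iso_def bij_betw_def order_preserving_reflecting_on_def
        intro!: exI[of _ "{}"])
  then show ?thesis
    unfolding aut_topology_def topology_generated_by_topspace by blast
qed

lemma openin_aut_evaluation:
  assumes "x \<in> S" shows "openin (aut_topology S r) {h \<in> order_auts S r. h x = y}"
proof (cases "\<exists>h\<in>order_auts S r. h x = y")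
  case True
  then obtain h where h: "h \<in> order_auts S r" "h x = y" by blast
  have "finite_partial_iso S r {x} {y} h"
    using assms h order_auts_in[OF h(1)] order_auts_iff[OF h(1)]
    by (auto simp: finite_partial_iso_def order_preserving_reflecting_on_def)
  then show ?thesis
    unfolding aut_topology_def
    by (intro topology_generated_by_Basis CollectI exI[of _ "{x}"] exI[of _ "{y}"] exI[of _ h])
      (use h in auto)
next
  case False
  then have "{h \<in> order_auts S r. h x = y} = {}" by blast
  then show ?thesis by (metis openin_empty)
qed

text \<open>
  A basic open set that contains \<open>h\<close> is cut out by the values of \<open>h\<close> itself on the finite set.
\<close>

lemma aut_open_contains_cylinder:
  assumes "openin (aut_topology S r) U" "h \<in> U"
  obtains A where "finite A" "A \<subseteq> S" "{h' \<in> order_auts S r. \<forall>x\<in>A. h' x = h x} \<subseteq> U"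
proof -
  have "generate_topology_on {{h \<in> order_auts S r. \<forall>x\<in>A. h x = p x} | A A' p. finite_partial_iso S r A A' p} U"
    using assms(1) by (simp add: aut_topology_def openin_topology_generated_by_iff)
  then have "h \<in> U \<longrightarrow> (\<exists>A. finite A \<and> A \<subseteq> S \<and> {h' \<in> order_auts S r. \<forall>x\<in>A. h' x = h x} \<subseteq> U)"
  proof induction
    case (Int a b)
    show ?case
    proof
      assume "h \<in> a \<inter> b"
      with Int obtain A B where "finite A" "A \<subseteq> S" "{h' \<in> order_auts S r. \<forall>x\<in>A. h' x = h x} \<subseteq> a"
        "finite B" "B \<subseteq> S" "{h' \<in> order_auts S r. \<forall>x\<in>B. h' x = h x} \<subseteq> b" by blast
      then show "\<exists>A. finite A \<and> A \<subseteq> S \<and> {h' \<in> order_auts S r. \<forall>x\<in>A. h' x = h x} \<subseteq> a \<inter> b"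
        by (intro exI[of _ "A \<union> B"]) auto
    qed
  next
    case (UN K)
    then show ?case by (meson Sup_upper UnionE order_trans)
  next
    case (Basis s)
    then obtain A A' p where s: "s = {h \<in> order_auts S r. \<forall>x\<in>A. h x = p x}"
      "finite_partial_iso S r A A' p" by blast
    then show ?case by (auto simp: finite_partial_iso_def intro!: exI[of _ A])
  qed simp
  then show thesis using assms(2) that by blast
qed

text \<open>
  The topology is that of pointwise convergence, \<open>S\<close> being discrete. Continuity is therefore a
  condition on single values, and the group operations are continuous because one value of a
  product or of an inverse depends on finitely many values of the factors.
\<close>

lemma continuous_map_aut_iff:
  "continuous_map Y (aut_topology S r) \<phi> \<longleftrightarrow>
     \<phi> \<in> topspace Y \<rightarrow> order_auts S r \<and>
     (\<forall>x\<in>S. \<forall>y\<in>S. openin Y {u \<in> topspace Y. \<phi> u x = y})" (is "?L \<longleftrightarrow> ?R")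
proof
  assume L: ?L
  have "{u \<in> topspace Y. \<phi> u \<in> {h \<in> order_auts S r. h x = y}} = {u \<in> topspace Y. \<phi> u x = y}" for x y
    using L by (auto simp: continuous_map_def Pi_iff)
  moreover have "openin Y {u \<in> topspace Y. \<phi> u \<in> {h \<in> order_auts S r. h x = y}}" if "x \<in> S" for x y
    using L openin_aut_evaluation[OF that, of r y] openin_continuous_map_preimage by blast
  ultimately show ?R
    using L by (simp add: continuous_map_def)
next
  assume R: ?R
  have "openin Y {u \<in> topspace Y. \<phi> u \<in> U}" if U: "openin (aut_topology S r) U" for U
  proof (subst openin_subopen, intro ballI)
    fix u assume u: "u \<in> {u \<in> topspace Y. \<phi> u \<in> U}"
    then obtain A where A: "finite A" "A \<subseteq> S" "{h' \<in> order_auts S r. \<forall>x\<in>A. h' x = \<phi> u x} \<subseteq> U"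
      using aut_open_contains_cylinder[OF U] by blast
    have \<phi>: "\<phi> v \<in> order_auts S r" if "v \<in> topspace Y" for v
      using R that by blast
    define N where "N = (\<Inter>x\<in>A. {v \<in> topspace Y. \<phi> v x = \<phi> u x}) \<inter> topspace Y"
    have "openin Y {v \<in> topspace Y. \<phi> v x = \<phi> u x}" if "x \<in> A" for x
      using R A(2) u that order_auts_in[OF \<phi>, of u x] by blast
    then have "openin Y N"
      unfolding N_def using A(1) by (intro openin_INT)
    moreover have "N \<subseteq> {u \<in> topspace Y. \<phi> u \<in> U}"
      using A(3) \<phi> unfolding N_def by blast
    moreover have "u \<in> N"
      using u unfolding N_def by blast
    ultimately show "\<exists>T. openin Y T \<and> u \<in> T \<and> T \<subseteq> {u \<in> topspace Y. \<phi> u \<in> U}"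
      by blast
  qed
  then show ?L using R by (simp add: continuous_map_def)
qed

lemma continuous_map_aut_comp:
  assumes "continuous_map Y (aut_topology S r) \<phi>" "continuous_map Y (aut_topology S r) \<psi>"
  shows "continuous_map Y (aut_topology S r) (\<lambda>u. \<phi> u \<circ> \<psi> u)"
  unfolding continuous_map_aut_iff
proof (intro conjI ballI)
  note R = assms[unfolded continuous_map_aut_iff]
  show "(\<lambda>u. \<phi> u \<circ> \<psi> u) \<in> topspace Y \<rightarrow> order_auts S r"
    using R by (auto intro: order_auts_comp)
  fix x y assume xy: "x \<in> S" "y \<in> S"
  have "{u \<in> topspace Y. (\<phi> u \<circ> \<psi> u) x = y}
      = (\<Union>z\<in>S. {u \<in> topspace Y. \<psi> u x = z} \<inter> {u \<in> topspace Y. \<phi> u z = y})"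
  proof -
    have "\<psi> u x \<in> S" if "u \<in> topspace Y" for u
      using R that order_auts_in[OF _ xy(1)] by blast
    then show ?thesis by auto
  qed
  moreover have "openin Y ({u \<in> topspace Y. \<psi> u x = z} \<inter> {u \<in> topspace Y. \<phi> u z = y})"
    if "z \<in> S" for z
    using R xy that by (simp add: openin_Int)
  then have "openin Y (\<Union>z\<in>S. {u \<in> topspace Y. \<psi> u x = z} \<inter> {u \<in> topspace Y. \<phi> u z = y})"
    by (auto intro: openin_Union)
  ultimately show "openin Y {u \<in> topspace Y. (\<phi> u \<circ> \<psi> u) x = y}" by simp
qed

lemma continuous_map_aut_inv:
  assumes "continuous_map Y (aut_topology S r) \<phi>"
  shows "continuous_map Y (aut_topology S r) (\<lambda>u. inv\<^bsub>aut_group S r\<^esub> (\<phi> u))"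
  unfolding continuous_map_aut_iff
proof (intro conjI ballI)
  note R = assms[unfolded continuous_map_aut_iff]
  show "(\<lambda>u. inv\<^bsub>aut_group S r\<^esub> (\<phi> u)) \<in> topspace Y \<rightarrow> order_auts S r"
    using R by (auto simp: aut_group_inv Pi_iff intro: order_auts_inv)
  fix x y assume xy: "x \<in> S" "y \<in> S"
  have "(inv\<^bsub>aut_group S r\<^esub> (\<phi> u)) x = y \<longleftrightarrow> \<phi> u y = x" if "u \<in> topspace Y" for u
  proof -
    have "\<phi> u \<in> order_auts S r" using R that by auto
    then show ?thesis
      by (metis aut_group_inv order_auts_permutes permutes_inverses)
  qed
  then have "{u \<in> topspace Y. (inv\<^bsub>aut_group S r\<^esub> (\<phi> u)) x = y} = {u \<in> topspace Y. \<phi> u y = x}"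
    by auto
  then show "openin Y {u \<in> topspace Y. (inv\<^bsub>aut_group S r\<^esub> (\<phi> u)) x = y}"
    using R xy by auto
qed

lemma continuous_map_aut_int_pow:
  assumes "continuous_map Y (aut_topology S r) \<phi>"
  shows "continuous_map Y (aut_topology S r) (\<lambda>u. \<phi> u [^]\<^bsub>aut_group S r\<^esub> (n::int))"
proof -
  interpret group "aut_group S r" by (rule group_aut_group)
  have nat: "continuous_map Y (aut_topology S r) (\<lambda>u. \<phi> u [^]\<^bsub>aut_group S r\<^esub> (k::nat))" for k
  proof (induction k)
    case 0
    have "(\<lambda>x. x) \<in> order_auts S r" using one_closed by (simp add: id_def)
    then show ?case by (simp add: continuous_map_const id_def)
  next
    case (Suc k)
    show ?case
      using continuous_map_aut_comp[OF Suc assms] by (simp add: comp_def)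
  qed
  show ?thesis
    unfolding int_pow_def2
    by (cases "n < 0") (simp_all only: if_True if_False nat continuous_map_aut_inv[OF nat])
qed

lemma word_eval_Nil [simp]: "word_eval G f g [] = \<one>\<^bsub>G\<^esub>"
  by (simp add: word_eval_def)

lemma word_eval_Cons [simp]:
  "word_eval G f g ((c, n) # w)
     = (case c of Letter_a \<Rightarrow> f | Letter_b \<Rightarrow> g) [^]\<^bsub>G\<^esub> n \<otimes>\<^bsub>G\<^esub> word_eval G f g w"
  by (simp add: word_eval_def)

lemma word_eval_closed:
  assumes "group G" "f \<in> carrier G" "g \<in> carrier G"
  shows "word_eval G f g w \<in> carrier G"
proof -
  interpret group G by fact
  show ?thesis
    using assms(2,3) by (induction w) (auto split: letter.split)
qed

lemma continuous_map_word_eval: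
  assumes "continuous_map Y (aut_topology S r) \<phi>" "continuous_map Y (aut_topology S r) \<psi>"
  shows "continuous_map Y (aut_topology S r) (\<lambda>u. word_eval (aut_group S r) (\<phi> u) (\<psi> u) w)"
proof (induction w)
  case Nil
  have "(\<lambda>x. x) \<in> order_auts S r"
    using monoid.one_closed[OF group.is_monoid[OF group_aut_group], of S r] by (simp add: id_def)
  then show ?case by (simp add: continuous_map_const id_def)
next
  case (Cons p w)
  obtain c n where p: "p = (c, n)" by force
  show ?case
    using continuous_map_aut_comp[OF continuous_map_aut_int_pow[OF assms(1)] Cons]
      continuous_map_aut_comp[OF continuous_map_aut_int_pow[OF assms(2)] Cons]
    by (cases c) (simp_all add: p comp_def)
qed

section \<open>Comeager and dense sets\<close>

text \<open>
  The definition wants an exact decomposition of the complement, so the closed sets missing the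
  members of \<open>\<U>\<close> are intersected with the complement of \<open>C\<close>.
\<close>

lemma comeager_inI:
  assumes "C \<subseteq> topspace T" "countable \<U>"
    and "\<And>U. U \<in> \<U> \<Longrightarrow> openin T U"
    and "\<And>U W. U \<in> \<U> \<Longrightarrow> openin T W \<Longrightarrow> W \<noteq> {} \<Longrightarrow> U \<inter> W \<noteq> {}"
    and "topspace T \<inter> \<Inter>\<U> \<subseteq> C"
  shows "comeager_in T C"
  unfolding comeager_in_def
proof (intro conjI exI[of _ "(\<lambda>U. topspace T - C - U) ` \<U>"] ballI)
  show "topspace T - C = \<Union> ((\<lambda>U. topspace T - C - U) ` \<U>)" using assms(5) by blast
  fix A assume "A \<in> (\<lambda>U. topspace T - C - U) ` \<U>"
  then obtain U where U: "U \<in> \<U>" "A = topspace T - C - U" by blast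
  let ?W = "T interior_of (T closure_of A)"
  have "T closure_of A \<subseteq> topspace T - U"
    by (intro closure_of_minimal) (use U assms(3) in auto)
  then have "U \<inter> ?W = {}" using interior_of_subset[of T "T closure_of A"] by blast
  then have "?W = {}" using assms(4)[OF U(1), of ?W] by auto
  then show "nowhere_dense_in T A" using U by (auto simp: nowhere_dense_in_def)
qed (use assms(1,2) in auto)

lemma dense_inI:
  assumes "D \<subseteq> topspace T" "\<And>U u. openin T U \<Longrightarrow> u \<in> U \<Longrightarrow> \<exists>d\<in>D. d \<in> U"
  shows "dense_in T D"
proof -
  have "x \<in> T closure_of D" if "x \<in> topspace T" for x
    unfolding in_closure_of using that assms(2) by blast
  then show ?thesis
    using assms(1) closure_of_subset_topspace[of T D] unfolding dense_in_def by blast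
qed

section \<open>Permutations without finite cycles\<close>

text \<open>For the total relation, the order automorphisms of \<open>S\<close> are all its permutations.\<close>

abbreviation Sym_pos :: "(nat \<Rightarrow> nat) monoid" where
  "Sym_pos \<equiv> aut_group {1..} (\<lambda>_ _. True)"

lemma order_auts_total_iff [simp]: "t \<in> order_auts S (\<lambda>_ _. True) \<longleftrightarrow> t permutes S"
  by (simp add: order_auts_def order_preserving_reflecting_on_def)

lemma Sym_pos_int_pow_permutes: "t permutes {1..} \<Longrightarrow> t [^]\<^bsub>Sym_pos\<^esub> (n::int) permutes {1..}"
  using aut_int_pow_in[of t "{1..}" "\<lambda>_ _. True" n] by simp

lemma Sym_pos_nat_pow: "t [^]\<^bsub>Sym_pos\<^esub> (n::nat) = t ^^ n"
proof (induction n)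
  case (Suc n)
  then show ?case by (simp add: funpow_swap1 fun_eq_iff)
qed simp

lemma no_finite_cycles_no_fixed_point:
  assumes t: "t permutes {1..}" "no_finite_cycles t" and "x \<ge> 1" and "n \<noteq> (0::int)"
  shows "(t [^]\<^bsub>Sym_pos\<^esub> n) x \<noteq> x"
proof
  assume fix_n: "(t [^]\<^bsub>Sym_pos\<^esub> n) x = x"
  then have "(t [^]\<^bsub>Sym_pos\<^esub> (- n)) x = x"
    using aut_int_pow_neg_cancel(1)[of t "{1..}" "\<lambda>_ _. True" n x] t(1) by simp
  with fix_n have "(t [^]\<^bsub>Sym_pos\<^esub> \<bar>n\<bar>) x = x" by (simp add: abs_if)
  moreover define m where "m = nat \<bar>n\<bar>"
  ultimately have fix_m: "(t ^^ m) x = x"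
    using int_pow_int[of Sym_pos t m] Sym_pos_nat_pow[of t m] by simp
  have "m > 0" using assms(4) m_def by simp
  have "{(t ^^ k) x | k. True} \<subseteq> (\<lambda>k. (t ^^ k) x) ` {..<m}"
  proof
    fix y assume "y \<in> {(t ^^ k) x | k. True}"
    then obtain k where "y = (t ^^ k) x" by blast
    then have "y = (t ^^ (k mod m)) x" using funpow_mod_eq[OF fix_m] by simp
    then show "y \<in> (\<lambda>k. (t ^^ k) x) ` {..<m}" using \<open>m > 0\<close> by auto
  qed
  then have "finite {(t ^^ k) x | k. True}" by (rule finite_subset) simp
  then show False using t(2) \<open>x \<ge> 1\<close> by (simp add: no_finite_cycles_def)
qed

lemma no_finite_cycles_inj_pow:
  assumes t: "t permutes {1..}" "no_finite_cycles t" and "x \<ge> 1"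
    and "(t [^]\<^bsub>Sym_pos\<^esub> j) x = (t [^]\<^bsub>Sym_pos\<^esub> k) x"
  shows "j = (k::int)"
proof (rule ccontr)
  assume "j \<noteq> k"
  have "(t [^]\<^bsub>Sym_pos\<^esub> (- k + j)) x = x"
    using aut_int_pow_add[of t "{1..}" "\<lambda>_ _. True" "- k" j x]
      aut_int_pow_neg_cancel(1)[of t "{1..}" "\<lambda>_ _. True" k x] t(1) assms(4) by simp
  then show False
    using no_finite_cycles_no_fixed_point[OF t \<open>x \<ge> 1\<close>, of "- k + j"] \<open>j \<noteq> k\<close> by simp
qed

text \<open>
  A point visits a given point at most once along its \<open>t\<close>-orbit, so all but finitely many powers
  of \<open>t\<close> move a finite set off itself.
\<close>

lemma no_finite_cycles_moves_finite_off:
  assumes t: "t permutes {1..}" "no_finite_cycles t" and C: "finite C" "C \<subseteq> {1..}"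
  obtains k :: int where "(t [^]\<^bsub>Sym_pos\<^esub> k) ` C \<inter> C = {}"
proof -
  define bad where "bad = (\<Union>a\<in>C. \<Union>b\<in>C. {k::int. (t [^]\<^bsub>Sym_pos\<^esub> k) a = b})"
  have "finite {k::int. (t [^]\<^bsub>Sym_pos\<^esub> k) a = b}" if "a \<in> C" for a b
  proof (cases "\<exists>k::int. (t [^]\<^bsub>Sym_pos\<^esub> k) a = b")
    case True
    then obtain k :: int where "(t [^]\<^bsub>Sym_pos\<^esub> k) a = b" by blast
    then have "{k::int. (t [^]\<^bsub>Sym_pos\<^esub> k) a = b} \<subseteq> {k}"
      using no_finite_cycles_inj_pow[OF t] C that by (auto simp: subset_iff)
    then show ?thesis by (rule finite_subset) simp
  qed simp
  then have "finite bad" unfolding bad_def using C(1) by blast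
  then obtain k where "k \<notin> bad" by (metis ex_new_if_finite infinite_UNIV_int)
  then have "(t [^]\<^bsub>Sym_pos\<^esub> k) ` C \<inter> C = {}" by (auto simp: bad_def)
  then show thesis by (rule that)
qed

section \<open>Irreducible words are not laws\<close>

text \<open>
  \<open>E\<close> holds the points already in use. The set \<open>Y\<close> also avoids the finitely many translates of
  \<open>E\<close> and of itself under small powers of \<open>t\<close>, so that a power of \<open>t\<close> that follows a visit to \<open>Y\<close>
  leads to an unused point.
\<close>

lemma fresh_set:
  assumes t: "t permutes {1..}" "no_finite_cycles t" and E: "finite E"
  shows "\<exists>Y. finite Y \<and> card Y = M \<and> Y \<subseteq> {1..} \<and> Y \<inter> E = {} \<and>
    (\<forall>y\<in>Y. \<forall>j. j \<noteq> 0 \<and> \<bar>j\<bar> \<le> N \<longrightarrow> (t [^]\<^bsub>Sym_pos\<^esub> (j::int)) y \<notin> E \<union> Y)"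
proof (induction M)
  case 0
  show ?case by (intro exI[of _ "{}"]) simp
next
  case (Suc M)
  then obtain Y where Y: "finite Y" "card Y = M" "Y \<subseteq> {1..}" "Y \<inter> E = {}"
    and YN: "\<forall>y\<in>Y. \<forall>j. j \<noteq> 0 \<and> \<bar>j\<bar> \<le> N \<longrightarrow> (t [^]\<^bsub>Sym_pos\<^esub> (j::int)) y \<notin> E \<union> Y"
    by (elim exE conjE)
  \<comment> \<open>The range of exponents is symmetric, so avoiding \<open>B\<close> keeps \<open>t\<^sup>j y\<close> away from \<open>E \<union> Y\<close> and also
    keeps \<open>t\<^sup>j u\<close> away from \<open>y\<close> for the earlier points \<open>u\<close>.\<close>
  define B where "B = (\<Union>j\<in>{-N..N}. (t [^]\<^bsub>Sym_pos\<^esub> (j::int)) ` (E \<union> Y)) \<union> (E \<union> Y)"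
  have "finite B" using E Y(1) by (simp add: B_def)
  then have "\<not> {1..} \<subseteq> B" using finite_subset infinite_Ici by blast
  then obtain y where y: "y \<ge> 1" "y \<notin> B" by auto
  have cancel: "(t [^]\<^bsub>Sym_pos\<^esub> (- j)) ((t [^]\<^bsub>Sym_pos\<^esub> j) v) = v" for j :: int and v
    using aut_int_pow_neg_cancel(1)[of t "{1..}" "\<lambda>_ _. True" j v] t(1) by simp
  have new: "(t [^]\<^bsub>Sym_pos\<^esub> j) y \<notin> E \<union> Y" if "\<bar>j\<bar> \<le> N" for j :: int
  proof
    assume "(t [^]\<^bsub>Sym_pos\<^esub> j) y \<in> E \<union> Y"
    then have "y \<in> (t [^]\<^bsub>Sym_pos\<^esub> (- j)) ` (E \<union> Y)" using cancel[of j y] by force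
    then show False using y(2) that unfolding B_def by fastforce
  qed
  have old: "(t [^]\<^bsub>Sym_pos\<^esub> j) u \<noteq> y" if "u \<in> Y" "\<bar>j\<bar> \<le> N" for j :: int and u
    using y(2) that unfolding B_def by fastforce
  have "y \<notin> Y" "y \<notin> E" using y(2) by (auto simp: B_def)
  show ?case
  proof (intro exI[of _ "insert y Y"] conjI ballI allI impI)
    show "card (insert y Y) = Suc M" using Y \<open>y \<notin> Y\<close> by simp
    fix u j assume u: "u \<in> insert y Y" and j: "j \<noteq> 0 \<and> \<bar>j\<bar> \<le> N"
    show "(t [^]\<^bsub>Sym_pos\<^esub> j) u \<notin> E \<union> insert y Y"
    proof (cases "u = y")
      case True
      then show ?thesis
        unfolding True using new[of j] j no_finite_cycles_no_fixed_point[OF t y(1), of j] by blast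
    next
      case False
      then show ?thesis using YN old[of u j] u j by blast
    qed
  qed (use Y y(1) \<open>y \<notin> E\<close> in auto)
qed

text \<open>
  The cycle \<open>c\<close> is listed as a periodic sequence \<open>e\<close> indexed by all integers, which makes negative
  powers as easy to follow as positive ones.
\<close>

lemma cyclic_permutation_exists:
  assumes "finite Z" "z \<in> Z"
  obtains c and e :: "int \<Rightarrow> 'a" where "c permutes Z" "e 0 = z" "range e \<subseteq> Z"
    "\<And>i. c (e i) = e (i + 1)" "\<And>m. m \<noteq> 0 \<Longrightarrow> \<bar>m\<bar> < int (card Z) \<Longrightarrow> e m \<noteq> z"
proof -
  define L where "L = int (card Z)"
  have L: "L > 0" using assms by (auto simp: L_def card_gt_0_iff)
  obtain g where g: "bij_betw g {0..<card Z} Z" using ex_bij_betw_nat_finite[OF assms(1)] by blast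
  then obtain i0 where i0: "i0 < card Z" "g i0 = z"
    using assms(2) by (metis atLeastLessThan_iff bij_betw_imp_surj_on imageE)
  define e where "e i = g (nat ((int i0 + i) mod L))" for i
  have idx: "nat (i mod L) \<in> {0..<card Z}" for i
    using L by (simp add: L_def nat_less_iff)
  have e_eq: "e i = e j \<longleftrightarrow> i mod L = j mod L" for i j
  proof -
    have "e i = e j \<longleftrightarrow> nat ((int i0 + i) mod L) = nat ((int i0 + j) mod L)"
      unfolding e_def by (rule inj_on_eq_iff[OF bij_betw_imp_inj_on[OF g] idx idx])
    also have "\<dots> \<longleftrightarrow> (int i0 + i) mod L = (int i0 + j) mod L"
      using L by (simp add: eq_nat_nat_iff)
    also have "\<dots> \<longleftrightarrow> i mod L = j mod L"
      by (metis add_diff_cancel_left mod_eq_dvd_iff)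
    finally show ?thesis .
  qed
  have e_in: "e i \<in> Z" for i
    unfolding e_def using g idx by (auto simp: bij_betw_def)
  have e_surj: "\<exists>i. y = e i" if "y \<in> Z" for y
  proof -
    have "y \<in> g ` {0..<card Z}" using that bij_betw_imp_surj_on[OF g] by simp
    then obtain n where n: "n < card Z" "g n = y" by auto
    then have "nat ((int i0 + (int n - int i0)) mod L) = n" by (simp add: L_def)
    then have "y = e (int n - int i0)" using n(2) unfolding e_def by simp
    then show ?thesis ..
  qed
  define c where "c y = (if y \<in> Z then e ((SOME i. y = e i) + 1) else y)" for y
  have c_e: "c (e i) = e (i + 1)" for i
  proof -
    have "e i = e (SOME j. e i = e j)" by (rule someI[of _ i]) simp
    then have "e ((SOME j. e i = e j) + 1) = e (i + 1)"
      unfolding e_eq by (metis mod_add_left_eq)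
    then show ?thesis by (simp add: c_def e_in)
  qed
  have "Z \<subseteq> c ` Z"
  proof
    fix y assume "y \<in> Z"
    then obtain i where "y = e i" using e_surj by blast
    then have "y = c (e (i - 1))" by (simp add: c_e)
    then show "y \<in> c ` Z" using e_in by blast
  qed
  moreover have "c ` Z \<subseteq> Z" by (auto simp: c_def e_in)
  ultimately have "c ` Z = Z" by blast
  then have "bij_betw c Z Z"
    using assms(1) by (simp add: bij_betw_def eq_card_imp_inj_on)
  then have c: "c permutes Z" by (rule bij_imp_permutes) (simp add: c_def)
  have e0: "e 0 = z" using i0 by (simp add: e_def L_def)
  have "e m \<noteq> z" if "m \<noteq> 0" "\<bar>m\<bar> < L" for m
  proof
    assume "e m = z"
    then have "L dvd \<bar>m\<bar>" using e_eq[of m 0] e0 by (simp add: mod_eq_0_iff_dvd)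
    then show False using that zdvd_imp_le[of L "\<bar>m\<bar>"] by simp
  qed
  then show thesis
    by (intro that[of c e] c e0 c_e) (use e_in in \<open>auto simp: L_def\<close>)
qed

lemma int_pow_along_sequence:
  assumes "s permutes {1..}" "\<And>i::int. s (e i) = e (i + 1)"
  shows "(s [^]\<^bsub>Sym_pos\<^esub> m) (e i) = e (i + m)"
proof -
  have nat: "(s ^^ k) (e i) = e (i + int k)" for k i
    by (induction k) (simp_all add: assms(2) algebra_simps)
  have pos: "(s [^]\<^bsub>Sym_pos\<^esub> (int k)) (e i) = e (i + int k)" for k i
    unfolding int_pow_int Sym_pos_nat_pow by (rule nat)
  show ?thesis
  proof (cases "m \<ge> 0")
    case True
    then show ?thesis using pos[of "nat m" i] by simp
  next
    case False
    then have "(s [^]\<^bsub>Sym_pos\<^esub> (- m)) (e (i + m)) = e i" using pos[of "nat (- m)" "i + m"] by simp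
    then show ?thesis
      using aut_int_pow_neg_cancel(2)[of s "{1..}" "\<lambda>_ _. True" m "e (i + m)"] assms(1) by simp
  qed
qed

text \<open>
  A state of the construction after reading \<open>w\<close> from the right: the walk has gone from \<open>x\<close> to \<open>z\<close>, and
  the part \<open>s\<close> of the second permutation chosen so far acts on the finite set \<open>D\<close> only. The evaluation
  is required for every \<open>s'\<close> agreeing with \<open>s\<close> on \<open>D\<close>, so that later choices outside \<open>D\<close> do no harm.
  The last two conditions prepare the next letter. Before a power of \<open>t\<close>, the end point must be one
  from which the nonzero powers of \<open>t\<close> with exponents up to \<open>N\<close>, a bound for the exponents of the
  word, lead outside \<open>D\<close> and not back to \<open>x\<close>. Before a power of the second letter, it must lie outside
  \<open>D\<close>, where \<open>s\<close> can still be chosen.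
\<close>

definition word_walk ::
    "(nat \<Rightarrow> nat) \<Rightarrow> int \<Rightarrow> (letter \<times> int) list \<Rightarrow> nat set \<Rightarrow> (nat \<Rightarrow> nat) \<Rightarrow> nat \<Rightarrow> nat \<Rightarrow> bool" where
  "word_walk t N w D s x z \<longleftrightarrow>
     finite D \<and> D \<subseteq> {1..} \<and> s permutes D \<and> x \<ge> 1 \<and> z \<ge> 1 \<and>
     (\<forall>s'. s' permutes {1..} \<longrightarrow> (\<forall>y\<in>D. s' y = s y) \<longrightarrow> word_eval Sym_pos t s' w x = z) \<and>
     (w \<noteq> [] \<longrightarrow> z \<noteq> x) \<and>
     (w = [] \<or> fst (hd w) = Letter_b \<longrightarrow>
        (\<forall>j. j \<noteq> 0 \<and> \<bar>j\<bar> \<le> N \<longrightarrow> (t [^]\<^bsub>Sym_pos\<^esub> (j::int)) z \<notin> insert x D)) \<and>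
     (w = [] \<or> fst (hd w) = Letter_a \<longrightarrow> z \<notin> D)"

text \<open>
  A power of \<open>t\<close> takes the walk outside \<open>D\<close>. For a power \<open>n\<close> of the second letter, the point \<open>z\<close> is
  joined to \<open>\<bar>n\<bar>\<close> fresh points in a cycle of length \<open>\<bar>n\<bar> + 1\<close>, whose \<open>n\<close>-th power moves \<open>z\<close> to one of
  the fresh points.
\<close>

lemma word_walk_exists:
  assumes t: "t permutes {1..}" "no_finite_cycles t"
    and w: "\<forall>(c, n)\<in>set w. n \<noteq> 0 \<and> \<bar>n\<bar> \<le> N" "distinct_adj (map fst w)"
  shows "\<exists>D s x z. word_walk t N w D s x z"
  using w
proof (induction w)
  case Nil
  have "word_walk t N [] {} id 1 1"
    using no_finite_cycles_no_fixed_point[OF t, of 1] by (simp add: word_walk_def permutes_id)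
  then show ?case by blast
next
  case (Cons p w)
  obtain c n where p: "p = (c, n)" by force
  have n: "n \<noteq> 0" "\<bar>n\<bar> \<le> N" using Cons.prems(1) p by auto
  have hd: "w = [] \<or> fst (hd w) \<noteq> c"
    using Cons.prems(2) p by (cases w) auto
  have "distinct_adj (map fst w)" using Cons.prems(2) by (auto simp: distinct_adj_Cons)
  with Cons obtain D s x z where walk: "word_walk t N w D s x z" by auto
  have D: "finite D" "D \<subseteq> {1..}" and s: "s permutes D" and x: "x \<ge> 1" and z: "z \<ge> 1"
    and eval: "\<forall>s'. s' permutes {1..} \<longrightarrow> (\<forall>y\<in>D. s' y = s y) \<longrightarrow> word_eval Sym_pos t s' w x = z"
    using walk unfolding word_walk_def by simp_all
  show ?case
  proof (cases c)
    case Letter_a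
    define z' where "z' = (t [^]\<^bsub>Sym_pos\<^esub> n) z"
    have "w = [] \<or> fst (hd w) = Letter_b" using hd Letter_a by (metis letter.exhaust)
    then have z': "z' \<notin> insert x D"
      using walk n unfolding word_walk_def z'_def by simp
    have "z' \<ge> 1"
      using permutes_in_image[OF Sym_pos_int_pow_permutes[OF t(1), of n], of z] z
      by (simp add: z'_def)
    have "word_eval Sym_pos t s' (p # w) x = z'"
      if "s' permutes {1..}" "\<forall>y\<in>D. s' y = s y" for s'
      using that eval by (simp add: p Letter_a z'_def)
    then have "word_walk t N (p # w) D s x z'"
      unfolding word_walk_def using D s x z' \<open>z' \<ge> 1\<close> by (simp add: p Letter_a)
    then show ?thesis by blast
  next
    case Letter_b
    have "w = [] \<or> fst (hd w) = Letter_a" using hd Letter_b by (metis letter.exhaust)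
    then have zD: "z \<notin> D" using walk unfolding word_walk_def by simp
    have "finite (insert z (insert x D))" using D(1) by simp
    from fresh_set[OF t this, of "nat \<bar>n\<bar>" N]
    obtain Y where Y: "finite Y" "card Y = nat \<bar>n\<bar>" "Y \<subseteq> {1..}" "Y \<inter> insert z (insert x D) = {}"
      and YN: "\<forall>y\<in>Y. \<forall>j. j \<noteq> 0 \<and> \<bar>j\<bar> \<le> N \<longrightarrow>
        (t [^]\<^bsub>Sym_pos\<^esub> (j::int)) y \<notin> insert z (insert x D) \<union> Y"
      by (elim exE conjE)
    define Z where "Z = insert z Y"
    have Z: "finite Z" "z \<in> Z" "Z \<subseteq> {1..}" "int (card Z) = \<bar>n\<bar> + 1" "Z \<inter> D = {}"
      using Y z zD by (auto simp: Z_def)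
    obtain c' and e :: "int \<Rightarrow> nat" where c': "c' permutes Z" and e: "e 0 = z" "range e \<subseteq> Z"
      "\<And>i. c' (e i) = e (i + 1)" "\<And>m. m \<noteq> 0 \<Longrightarrow> \<bar>m\<bar> < int (card Z) \<Longrightarrow> e m \<noteq> z"
      using cyclic_permutation_exists[OF Z(1,2)] by metis
    have "e n \<noteq> z" using e(4)[of n] n(1) Z(4) by simp
    then have en: "e n \<in> Y" using e(2) by (auto simp: Z_def)
    have s_c': "(s \<circ> c') y = s y" if "y \<in> D" for y
      using that Z(5) permutes_not_in[OF c'] by force
    have c'_Z: "(s \<circ> c') y = c' y" if "y \<in> Z" for y
      using that Z(5) permutes_in_image[OF c'] permutes_not_in[OF s] by force
    have "word_eval Sym_pos t s' (p # w) x = e n"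
      if s': "s' permutes {1..}" and agree: "\<forall>y\<in>D \<union> Z. s' y = (s \<circ> c') y" for s'
    proof -
      have "word_eval Sym_pos t s' w x = z"
        using eval s' agree s_c' by simp
      moreover have "s' (e i) = e (i + 1)" for i
      proof -
        have "e i \<in> Z" using e(2) by blast
        then show ?thesis using agree c'_Z[of "e i"] e(3)[of i] by simp
      qed
      then have "(s' [^]\<^bsub>Sym_pos\<^esub> n) (e 0) = e n"
        using int_pow_along_sequence[OF s', of e n 0] by simp
      ultimately show ?thesis
        using e(1) by (simp add: p Letter_b)
    qed
    moreover have "s \<circ> c' permutes D \<union> Z"
      by (intro permutes_compose permutes_subset[OF s] permutes_subset[OF c']) auto
    moreover have "(t [^]\<^bsub>Sym_pos\<^esub> j) (e n) \<notin> insert x (D \<union> Z)" if "j \<noteq> 0 \<and> \<bar>j\<bar> \<le> N" for j :: int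
      using YN en that unfolding Z_def by blast
    moreover have "e n \<noteq> x" "e n \<ge> 1" using en Y(3,4) by auto
    ultimately have "word_walk t N (p # w) (D \<union> Z) (s \<circ> c') x (e n)"
      unfolding word_walk_def using D Z(1,3) x by (simp add: p Letter_b)
    then show ?thesis by blast
  qed
qed

lemma irreducible_word_escapes:
  assumes "t permutes {1..}" "no_finite_cycles t" "irreducible_word w"
  obtains s x where "s permutes {1..}" "x \<ge> 1" "word_eval Sym_pos t s w x \<noteq> x"
proof -
  define N where "N = Max ((\<lambda>(c, n). \<bar>n\<bar>) ` set w)"
  have "\<bar>n\<bar> \<le> N" if "(c, n) \<in> set w" for c n
    unfolding N_def using that by (intro Max_ge) force+
  then have w: "\<forall>(c, n)\<in>set w. n \<noteq> 0 \<and> \<bar>n\<bar> \<le> N" "distinct_adj (map fst w)" "w \<noteq> []"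
    using assms(3) by (auto simp: irreducible_word_def)
  obtain D s x z where walk: "word_walk t N w D s x z"
    using word_walk_exists[OF assms(1,2) w(1,2)] by blast
  then have "D \<subseteq> {1..}" "s permutes D" by (simp_all add: word_walk_def)
  then have "s permutes {1..}" using permutes_subset by blast
  moreover have "x \<ge> 1" "word_eval Sym_pos t s w x \<noteq> x"
    using walk w(3) \<open>s permutes {1..}\<close> by (auto simp: word_walk_def)
  ultimately show thesis by (rule that)
qed

section \<open>Automorphisms of the columns\<close>

abbreviation AutB_set :: "(nat \<times> rat \<Rightarrow> nat \<times> rat) set" where
  "AutB_set \<equiv> order_auts Bw Bw_le"

lemma mem_Bw_iff: "x \<in> Bw \<longleftrightarrow> fst x \<ge> 1"
  by (cases x) (simp add: Bw_def)

text \<open>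
  Two points lie in the same column iff they are comparable, and comparability is preserved.
\<close>

lemma AutB_same_column:
  assumes f: "f \<in> AutB_set" and xy: "x \<in> Bw" "y \<in> Bw"
  shows "fst (f x) = fst (f y) \<longleftrightarrow> fst x = fst y"
proof -
  have *: "fst u = fst v \<longleftrightarrow> Bw_le u v \<or> Bw_le v u" for u v
    by (auto simp: Bw_le_def)
  show ?thesis
    unfolding * by (simp only: order_auts_iff[OF f] xy)
qed

lemma AutB_outside: "f \<in> AutB_set \<Longrightarrow> f (0, p) = (0, p)"
  by (rule permutes_not_in[OF order_auts_permutes]) (auto simp: mem_Bw_iff)

lemma is_tau_column:
  assumes f: "f \<in> AutB_set"
  shows "is_tau f (\<lambda>k. fst (f (k, 0)))"
proof -
  define t where "t k = fst (f (k, 0))" for k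
  define h where "h k p = snd (f (k, p))" for k p
  have f_eq: "f (k, p) = (t k, h k p)" if "k \<ge> 1" for k p
    using AutB_same_column[OF f, of "(k, p)" "(k, 0)"] that
    by (simp add: t_def h_def mem_Bw_iff prod_eq_iff)
  have f_inj: "f x = f y \<longleftrightarrow> x = y" for x y
    using permutes_inj[OF order_auts_permutes[OF f]] by (auto dest: injD)
  have t_inj: "t k = t l \<longleftrightarrow> k = l" if "k \<ge> 1" "l \<ge> 1" for k l
    using AutB_same_column[OF f, of "(k, 0)" "(l, 0)"] that by (simp add: t_def mem_Bw_iff)
  have onto: "\<exists>k q. k \<ge> 1 \<and> t k = l \<and> h k q = p" if "l \<ge> 1" for l p
  proof -
    have "(l, p) \<in> f ` Bw"
      using that permutes_image[OF order_auts_permutes[OF f]] by (simp add: mem_Bw_iff)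
    then obtain k q where "f (k, q) = (l, p)" "k \<ge> 1" by (force simp: mem_Bw_iff)
    then show ?thesis using f_eq by auto
  qed
  have "t permutes {1..}"
  proof (rule bij_imp_permutes)
    have "t ` {1..} \<subseteq> {1..}"
      using order_auts_in[OF f, of "(_, 0)"] by (auto simp: mem_Bw_iff t_def)
    moreover have "{1..} \<subseteq> t ` {1..}" using onto by (fastforce simp: image_iff)
    ultimately show "bij_betw t {1..} {1..}" using t_inj by (auto simp: bij_betw_def inj_on_def)
    show "t k = k" if "k \<notin> {1..}" for k
      using that AutB_outside[OF f, of 0] by (cases k) (auto simp: t_def)
  qed
  moreover have "h k \<in> order_auts UNIV (\<le>)" if k: "k \<ge> 1" for k
  proof -
    have "inj (h k)"
    proof (rule injI)
      fix p q assume "h k p = h k q"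
      then show "p = q" using f_eq[OF k, of p] f_eq[OF k, of q] f_inj[of "(k, p)" "(k, q)"] by simp
    qed
    moreover have "\<exists>q. h k q = p" for p
    proof -
      have "t k \<ge> 1" using order_auts_in[OF f, of "(k, 0)"] k by (simp add: t_def mem_Bw_iff)
      then obtain l q where "l \<ge> 1" "t l = t k" "h l q = p" using onto by blast
      then show ?thesis using t_inj k by auto
    qed
    then have "surj (h k)" by (metis surjI)
    ultimately have "h k permutes UNIV"
      by (intro bij_imp_permutes) (simp_all add: bij_betw_def)
    moreover have "p \<le> q \<longleftrightarrow> h k p \<le> h k q" for p q
      using order_auts_iff[OF f, of "(k, p)" "(k, q)"] k f_eq by (simp add: Bw_le_def mem_Bw_iff)
    ultimately show ?thesis
      by (simp add: order_auts_def order_preserving_reflecting_on_def)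
  qed
  ultimately have "is_tau f t" unfolding is_tau_def using f_eq by blast
  then show ?thesis by (simp add: t_def[abs_def])
qed

lemma is_tau_eq_tau:
  assumes "is_tau f t" shows "tau f = t"
  unfolding tau_def
proof (rule the_equality)
  fix t' assume t': "is_tau f t'"
  show "t' = t"
  proof
    fix k
    show "t' k = t k"
    proof (cases "k \<ge> 1")
      case True
      then show ?thesis using assms t' unfolding is_tau_def by (metis prod.inject)
    next
      case False
      then show ?thesis using assms t' unfolding is_tau_def
        by (metis atLeast_iff permutes_not_in)
    qed
  qed
qed fact

lemma is_tau_tau: "f \<in> AutB_set \<Longrightarrow> is_tau f (tau f)"
  using is_tau_column is_tau_eq_tau by metis

lemma tau_permutes: "f \<in> AutB_set \<Longrightarrow> tau f permutes {1..}"
  using is_tau_tau by (simp add: is_tau_def)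

lemma fst_AutB:
  assumes "f \<in> AutB_set" shows "fst (f x) = tau f (fst x)"
proof (cases "x \<in> Bw")
  case True
  have "tau f (fst x) = fst (f (fst x, 0))"
    using is_tau_eq_tau[OF is_tau_column[OF assms]] by simp
  then show ?thesis
    using AutB_same_column[OF assms True, of "(fst x, 0)"] True by (simp add: mem_Bw_iff)
next
  case False
  then have "fst x \<notin> {1..}" by (simp add: mem_Bw_iff)
  then show ?thesis
    using False permutes_not_in[OF order_auts_permutes[OF assms]] permutes_not_in[OF tau_permutes[OF assms]]
    by metis
qed

lemma group_hom_tau: "group_hom AutB Sym_pos tau"
proof -
  have "tau \<in> hom AutB Sym_pos"
  proof (rule homI)
    fix f g assume fg: "f \<in> carrier AutB" "g \<in> carrier AutB"
    then have "tau (f \<circ> g) k = (tau f \<circ> tau g) k" for k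
      using fst_AutB[of "f \<circ> g" "(k, 0)"] fst_AutB[of f "g (k, 0)"] fst_AutB[of g "(k, 0)"]
      by (simp add: order_auts_comp)
    then show "tau (f \<otimes>\<^bsub>AutB\<^esub> g) = tau f \<otimes>\<^bsub>Sym_pos\<^esub> tau g" by auto
  qed (use tau_permutes in simp)
  then show ?thesis
    by (intro group_hom.intro group_hom_axioms.intro group_aut_group)
qed

lemma tau_int_pow:
  "f \<in> AutB_set \<Longrightarrow> tau (f [^]\<^bsub>AutB\<^esub> (k::int)) = tau f [^]\<^bsub>Sym_pos\<^esub> k"
  using group_hom.hom_int_pow[OF group_hom_tau, of f k] by simp

definition column_aut :: "(nat \<Rightarrow> nat) \<Rightarrow> (nat \<Rightarrow> rat \<Rightarrow> rat) \<Rightarrow> nat \<times> rat \<Rightarrow> nat \<times> rat" where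
  "column_aut \<pi> h x = (if x \<in> Bw then (\<pi> (fst x), h (fst x) (snd x)) else x)"

lemma column_aut:
  assumes \<pi>: "\<pi> permutes {1..}" and h: "\<And>k. k \<ge> 1 \<Longrightarrow> h k \<in> order_auts UNIV (\<le>)"
  shows "column_aut \<pi> h \<in> AutB_set" "tau (column_aut \<pi> h) = \<pi>"
proof -
  have \<pi>1: "\<pi> k \<ge> 1 \<longleftrightarrow> k \<ge> 1" for k
    using permutes_in_image[OF \<pi>, of k] by simp
  have \<pi>_eq: "\<pi> k = \<pi> l \<longleftrightarrow> k = l" for k l
    using permutes_inj[OF \<pi>] by (auto dest: injD)
  have h_bij: "bij (h k)" if "k \<ge> 1" for k
    using order_auts_permutes[OF h[OF that]] by (rule permutes_bij)
  have h_le: "h k p \<le> h k q \<longleftrightarrow> p \<le> q" if "k \<ge> 1" for k p q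
    using order_auts_iff[OF h[OF that], of p q] by simp
  have "inj_on (column_aut \<pi> h) Bw"
  proof (rule inj_onI)
    fix x y assume xy: "x \<in> Bw" "y \<in> Bw" "column_aut \<pi> h x = column_aut \<pi> h y"
    then have "fst x = fst y" "h (fst x) (snd x) = h (fst x) (snd y)"
      by (auto simp: column_aut_def \<pi>_eq)
    then show "x = y"
      using bij_is_inj[OF h_bij, of "fst x"] xy(1) by (auto simp: mem_Bw_iff prod_eq_iff dest: injD)
  qed
  moreover have "column_aut \<pi> h ` Bw \<subseteq> Bw"
  proof (rule image_subsetI)
    show "column_aut \<pi> h x \<in> Bw" if "x \<in> Bw" for x
      using that \<pi>1[of "fst x"] by (simp add: column_aut_def mem_Bw_iff)
  qed
  moreover have "x \<in> column_aut \<pi> h ` Bw" if x: "x \<in> Bw" for x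
  proof -
    obtain k where k: "\<pi> k = fst x" using permutes_surj[OF \<pi>] by (metis surjD)
    then have "k \<ge> 1" using \<pi>1[of k] x by (simp add: mem_Bw_iff)
    then obtain p where "h k p = snd x" using bij_is_surj[OF h_bij] by (metis surjD)
    then have "x = column_aut \<pi> h (k, p)" "(k, p) \<in> Bw"
      using k \<open>k \<ge> 1\<close> by (simp_all add: column_aut_def mem_Bw_iff)
    then show ?thesis by blast
  qed
  ultimately have "bij_betw (column_aut \<pi> h) Bw Bw" unfolding bij_betw_def by blast
  then have "column_aut \<pi> h permutes Bw"
    by (rule bij_imp_permutes) (simp add: column_aut_def)
  moreover have "Bw_le x y \<longleftrightarrow> Bw_le (column_aut \<pi> h x) (column_aut \<pi> h y)"
    if "x \<in> Bw" "y \<in> Bw" for x y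
    using that h_le by (auto simp: Bw_le_def column_aut_def \<pi>_eq mem_Bw_iff)
  ultimately show "column_aut \<pi> h \<in> AutB_set"
    by (simp add: order_auts_def order_preserving_reflecting_on_def)
  have "is_tau (column_aut \<pi> h) \<pi>"
    unfolding is_tau_def using \<pi> h
    by (intro conjI exI[of _ h]) (auto simp: column_aut_def mem_Bw_iff)
  then show "tau (column_aut \<pi> h) = \<pi>" by (rule is_tau_eq_tau)
qed

lemma order_auts_id: "id \<in> order_auts S r"
  using monoid.one_closed[OF group.is_monoid[OF group_aut_group], of S r] by simp

lemma AutB_as_column_aut:
  assumes "f \<in> AutB_set"
  obtains h where "\<And>k. k \<ge> 1 \<Longrightarrow> h k \<in> order_auts UNIV (\<le>)"
    "\<And>x. x \<in> Bw \<Longrightarrow> f x = (tau f (fst x), h (fst x) (snd x))"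
proof -
  obtain h where h: "\<forall>k\<ge>1. h k \<in> order_auts UNIV (\<le>) \<and> (\<forall>p. f (k, p) = (tau f k, h k p))"
    using is_tau_tau[OF assms] unfolding is_tau_def by blast
  show thesis
    by (rule that[of h]) (use h in \<open>auto simp: mem_Bw_iff\<close>)
qed

lemma finite_injection_extends_to_permutation:
  assumes A: "finite A" "A \<subseteq> S" and \<phi>: "inj_on \<phi> A" "\<phi> ` A \<subseteq> S"
  obtains \<pi> where "\<pi> permutes S" "\<And>a. a \<in> A \<Longrightarrow> \<pi> a = \<phi> a"
proof -
  define E where "E = A \<union> \<phi> ` A"
  \<comment> \<open>\<open>A\<close> and its image have the same size, hence so do their complements in the finite set \<open>E\<close>.\<close>
  have "card (E - A) = card (E - \<phi> ` A)"
    using A(1) \<phi>(1) by (simp add: E_def card_Diff_subset card_image)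
  then obtain \<psi> where \<psi>: "bij_betw \<psi> (E - A) (E - \<phi> ` A)"
    using A(1) finite_same_card_bij[of "E - A" "E - \<phi> ` A"] by (auto simp: E_def)
  define \<pi> where "\<pi> x = (if x \<in> A then \<phi> x else if x \<in> E then \<psi> x else x)" for x
  have "bij_betw \<pi> A (\<phi> ` A)"
    using \<phi>(1) by (auto simp: bij_betw_def \<pi>_def inj_on_def)
  moreover have "bij_betw \<pi> (E - A) (E - \<phi> ` A)"
    using \<psi> by (rule bij_betw_cong[THEN iffD1, rotated]) (simp add: \<pi>_def)
  ultimately have "bij_betw \<pi> (A \<union> (E - A)) (\<phi> ` A \<union> (E - \<phi> ` A))"
    by (rule bij_betw_combine) blast
  then have "bij_betw \<pi> E E" by (simp add: E_def Un_absorb1 Un_absorb2)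
  then have "\<pi> permutes E" by (rule bij_imp_permutes) (auto simp: \<pi>_def E_def)
  then have "\<pi> permutes S" by (rule permutes_subset) (use A \<phi> in \<open>auto simp: E_def\<close>)
  then show thesis by (rule that) (simp add: \<pi>_def)
qed

text \<open>
  All remaining columns can be matched by an arbitrary permutation, with the identity of \<open>\<rat>\<close>
  between any two matched columns.
\<close>

lemma AutB_glue:
  assumes g: "g1 \<in> AutB_set" "g2 \<in> AutB_set"
    and C: "finite C1" "finite C2" "C1 \<subseteq> {1..}" "C2 \<subseteq> {1..}" "C1 \<inter> C2 = {}"
    and im: "tau g1 ` C1 \<inter> tau g2 ` C2 = {}"
  obtains g where "g \<in> AutB_set" "\<And>x. fst x \<in> C1 \<Longrightarrow> g x = g1 x" "\<And>x. fst x \<in> C2 \<Longrightarrow> g x = g2 x"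
proof -
  obtain h1 where h1: "\<And>k. k \<ge> 1 \<Longrightarrow> h1 k \<in> order_auts UNIV (\<le>)"
    "\<And>x. x \<in> Bw \<Longrightarrow> g1 x = (tau g1 (fst x), h1 (fst x) (snd x))"
    using AutB_as_column_aut[OF g(1)] by blast
  obtain h2 where h2: "\<And>k. k \<ge> 1 \<Longrightarrow> h2 k \<in> order_auts UNIV (\<le>)"
    "\<And>x. x \<in> Bw \<Longrightarrow> g2 x = (tau g2 (fst x), h2 (fst x) (snd x))"
    using AutB_as_column_aut[OF g(2)] by blast
  define \<phi> where "\<phi> k = (if k \<in> C1 then tau g1 k else tau g2 k)" for k
  have inj: "inj_on (tau g1) C1" "inj_on (tau g2) C2"
    using permutes_inj[OF tau_permutes[OF g(1)]] permutes_inj[OF tau_permutes[OF g(2)]]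
    by (auto intro: inj_on_subset)
  have "inj_on \<phi> (C1 \<union> C2)"
  proof (rule inj_onI)
    fix a b assume "a \<in> C1 \<union> C2" "b \<in> C1 \<union> C2" "\<phi> a = \<phi> b"
    then show "a = b"
      using inj C(5) im by (auto simp: \<phi>_def split: if_splits dest: inj_onD)
  qed
  moreover have "\<phi> ` (C1 \<union> C2) \<subseteq> {1..}"
    using C(3,4) permutes_in_image[OF tau_permutes[OF g(1)]] permutes_in_image[OF tau_permutes[OF g(2)]]
    unfolding \<phi>_def by auto
  ultimately obtain \<pi> where \<pi>: "\<pi> permutes {1..}" "\<And>k. k \<in> C1 \<union> C2 \<Longrightarrow> \<pi> k = \<phi> k"
    using finite_injection_extends_to_permutation[of "C1 \<union> C2" "{1..}" \<phi>] C by auto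
  define h where "h k = (if k \<in> C1 then h1 k else if k \<in> C2 then h2 k else id)" for k
  have "h k \<in> order_auts UNIV (\<le>)" if "k \<ge> 1" for k
    using that h1(1) h2(1) by (simp add: h_def order_auts_id)
  then have "column_aut \<pi> h \<in> AutB_set" using column_aut(1) \<pi>(1) by blast
  moreover have "column_aut \<pi> h x = g1 x" if "fst x \<in> C1" for x
    using that C(3) \<pi>(2) h1(2) by (auto simp: column_aut_def mem_Bw_iff h_def \<phi>_def)
  moreover have "column_aut \<pi> h x = g2 x" if "fst x \<in> C2" for x
    using that C(4,5) \<pi>(2) h2(2) by (auto simp: column_aut_def mem_Bw_iff h_def \<phi>_def)
  ultimately show thesis by (rule that)
qed

abbreviation conj_pow :: "(nat \<times> rat \<Rightarrow> nat \<times> rat) \<Rightarrow> int \<Rightarrow> (nat \<times> rat \<Rightarrow> nat \<times> rat) \<Rightarrow> nat \<times> rat \<Rightarrow> nat \<times> rat" where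
  "conj_pow f k g \<equiv> f [^]\<^bsub>AutB\<^esub> k \<otimes>\<^bsub>AutB\<^esub> g \<otimes>\<^bsub>AutB\<^esub> f [^]\<^bsub>AutB\<^esub> (- k)"

text \<open>
  The second requirement says that \<open>g'\<close> agrees with \<open>f\<^sup>-\<^sup>k q f\<^sup>k\<close> on \<open>f\<^sup>-\<^sup>k A\<close>. If \<open>\<tau>\<^sub>f\<^sup>k\<close> moves the columns
  of \<open>K\<close> off themselves, the columns in the source and target of this prescription are disjoint from
  those of \<open>g\<close> on \<open>A\<close>, and the two prescriptions can be glued. The power \<open>k\<close> depends on \<open>K\<close> only,
  hence serves all entries of a tuple at once.
\<close>

lemma conj_pow_amalgamation:
  assumes f: "f \<in> XB" and K: "finite K" "K \<subseteq> Bw"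
  obtains k :: int where "\<And>g q A. \<lbrakk>g \<in> AutB_set; q \<in> AutB_set; A \<subseteq> K; g ` A \<subseteq> K; q ` A \<subseteq> K\<rbrakk> \<Longrightarrow>
    \<exists>g'\<in>AutB_set. (\<forall>x\<in>A. g' x = g x) \<and> (\<forall>x\<in>A. conj_pow f k g' x = q x)"
proof -
  have fA: "f \<in> AutB_set" and tf: "no_finite_cycles (tau f)" using f by (simp_all add: XB_def)
  define P where "P k = f [^]\<^bsub>AutB\<^esub> k" for k :: int
  define T where "T k = tau f [^]\<^bsub>Sym_pos\<^esub> k" for k :: int
  have P: "P k \<in> AutB_set" "tau (P k) = T k" for k
    using aut_int_pow_in[OF fA] tau_int_pow[OF fA] by (simp_all add: P_def T_def)
  have P_cancel: "P (- k) (P k x) = x" "P k (P (- k) x) = x" for k x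
    using aut_int_pow_neg_cancel[OF fA] by (simp_all add: P_def)
  have T_cancel: "T (- k) (T k n) = n" "T k (T (- k) n) = n" for k n
    using aut_int_pow_neg_cancel[of "tau f" "{1..}" "\<lambda>_ _. True" k n] tau_permutes[OF fA]
    by (simp_all add: T_def)
  have "finite (fst ` K)" "fst ` K \<subseteq> {1..}" using K by (auto simp: mem_Bw_iff)
  then obtain k where k: "T k ` fst ` K \<inter> fst ` K = {}"
    using no_finite_cycles_moves_finite_off[OF tau_permutes[OF fA] tf] unfolding T_def by blast
  show thesis
  proof (rule that[of k])
    fix g q A assume g: "g \<in> AutB_set" and q: "q \<in> AutB_set"
      and A: "A \<subseteq> K" and gA: "g ` A \<subseteq> K" and qA: "q ` A \<subseteq> K"
    define C1 where "C1 = fst ` A"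
    define C2 where "C2 = T (- k) ` C1"
    define g2 where "g2 = P (- k) \<circ> q \<circ> P k"
    have g2: "g2 \<in> AutB_set" unfolding g2_def by (intro order_auts_comp P q)
    have tau_g2: "tau g2 n = T (- k) (tau q (T k n))" for n
      using fst_AutB[OF g2, of "(n, 0)"] fst_AutB[OF P(1), of "- k"] fst_AutB[OF P(1), of k]
        fst_AutB[OF q] P(2) by (simp add: g2_def)
    have im: "tau g ` C1 \<subseteq> fst ` K" "tau q ` C1 \<subseteq> fst ` K"
    proof -
      have "tau g ` C1 = fst ` g ` A" "tau q ` C1 = fst ` q ` A"
        by (simp_all add: C1_def image_image fst_AutB[OF g] fst_AutB[OF q])
      then show "tau g ` C1 \<subseteq> fst ` K" "tau q ` C1 \<subseteq> fst ` K"
        using image_mono[OF gA] image_mono[OF qA] by simp_all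
    qed
    have off: "m \<notin> T (- k) ` B" if "m \<in> fst ` K" "B \<subseteq> fst ` K" for m B
    proof
      assume "m \<in> T (- k) ` B"
      then have "T k m \<in> B" using T_cancel(2) by auto
      then show False using that k by blast
    qed
    have C1K: "C1 \<subseteq> fst ` K" using A by (auto simp: C1_def)
    have "finite C1" using finite_subset[OF A K(1)] by (simp add: C1_def)
    moreover have "C1 \<subseteq> {1..}" using C1K \<open>fst ` K \<subseteq> {1..}\<close> by blast
    moreover have "C2 \<subseteq> {1..}"
      using \<open>C1 \<subseteq> {1..}\<close> permutes_in_image[OF tau_permutes[OF P(1), of "- k"]] P(2)
      unfolding C2_def by fastforce
    moreover have "C1 \<inter> C2 = {}" using off C1K unfolding C2_def by blast
    moreover have "tau g2 ` C2 = T (- k) ` tau q ` C1"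
      by (simp add: C2_def image_image tau_g2 T_cancel)
    then have "tau g ` C1 \<inter> tau g2 ` C2 = {}" using off im by blast
    moreover have "finite C2" using \<open>finite C1\<close> by (simp add: C2_def)
    ultimately obtain g' where g': "g' \<in> AutB_set" "\<And>x. fst x \<in> C1 \<Longrightarrow> g' x = g x"
      "\<And>x. fst x \<in> C2 \<Longrightarrow> g' x = g2 x"
      using AutB_glue[OF g g2] by metis
    have "conj_pow f k g' x = q x" if "x \<in> A" for x
    proof -
      have "fst (P (- k) x) \<in> C2" using that fst_AutB[OF P(1)] P(2) by (simp add: C1_def C2_def)
      then have "g' (P (- k) x) = P (- k) (q x)" using g'(3) P_cancel by (simp add: g2_def)
      then show ?thesis using P_cancel by (simp add: P_def)
    qed
    moreover have "g' x = g x" if "x \<in> A" for x using g'(2) that by (simp add: C1_def)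
    ultimately show "\<exists>g'\<in>AutB_set. (\<forall>x\<in>A. g' x = g x) \<and> (\<forall>x\<in>A. conj_pow f k g' x = q x)"
      using g'(1) by blast
  qed
qed

text \<open>
  Transport the successor on the integers to the positive naturals, and let it shift the columns.
\<close>

lemma XB_nonempty: "XB \<noteq> {}"
proof -
  define t where "t n = (if n \<ge> 1 then Suc (int_encode (int_decode (n - 1) + 1)) else n)" for n
  have t: "t (Suc (int_encode i)) = Suc (int_encode (i + 1))" for i
    by (simp add: t_def)
  have code: "\<exists>i. n = Suc (int_encode i)" if "n \<ge> 1" for n
    using that by (intro exI[of _ "int_decode (n - 1)"]) simp
  have "t permutes {1..}"
  proof (rule bij_imp_permutes)
    have "n \<in> t ` {1..}" if n: "n \<ge> 1" for n
    proof -
      obtain i where "n = Suc (int_encode i)" using code[OF n] by blast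
      then have "n = t (Suc (int_encode (i - 1)))" by (simp add: t)
      then show ?thesis by (rule image_eqI) simp
    qed
    moreover have "t ` {1..} \<subseteq> {1..}" by (auto simp: t_def)
    moreover have "inj_on t {1..}"
    proof (rule inj_onI)
      fix a b assume ab: "a \<in> {1..}" "b \<in> {1..}" "t a = t b"
      obtain i j where "a = Suc (int_encode i)" "b = Suc (int_encode j)"
        using code[of a] code[of b] ab by auto
      then show "a = b" using ab(3) by (simp add: t int_encode_eq)
    qed
    ultimately show "bij_betw t {1..} {1..}" unfolding bij_betw_def by auto
  qed (simp add: t_def)
  moreover have "no_finite_cycles t"
    unfolding no_finite_cycles_def
  proof (intro allI impI)
    fix n :: nat assume "n \<ge> 1"
    then obtain i where n: "n = Suc (int_encode i)" using code by blast
    have "(t ^^ k) n = Suc (int_encode (i + int k))" for k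
      by (induction k) (simp_all add: n t algebra_simps)
    then have "inj (\<lambda>k. (t ^^ k) n)" by (auto simp: inj_def int_encode_eq)
    then have "infinite (range (\<lambda>k. (t ^^ k) n))" by (rule range_inj_infinite)
    then show "infinite {(t ^^ k) n | k. True}" by (simp add: full_SetCompr_eq)
  qed
  ultimately have "column_aut t (\<lambda>_. id) \<in> XB"
    using column_aut[of t "\<lambda>_. id"] by (simp add: XB_def order_auts_id)
  then show ?thesis by blast
qed

section \<open>Dense conjugates force freeness\<close>

lemma group_hom_word_eval:
  assumes "group_hom G H \<phi>" "f \<in> carrier G" "g \<in> carrier G"
  shows "\<phi> (word_eval G f g w) = word_eval H (\<phi> f) (\<phi> g) w"
proof -
  interpret group_hom G H \<phi> by fact
  show ?thesis
  proof (induction w)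
    case (Cons p w)
    obtain c n where p: "p = (c, n)" by force
    show ?case
      using assms(2,3) Cons word_eval_closed[OF G.is_group assms(2,3)]
      by (cases c) (simp_all add: p hom_int_pow)
  qed simp
qed

lemma conj_int_pow_hom:
  fixes G (structure)
  assumes "group G" "f \<in> carrier G"
  shows "group_hom G G (\<lambda>x. f [^]\<^bsub>G\<^esub> (k::int) \<otimes>\<^bsub>G\<^esub> x \<otimes>\<^bsub>G\<^esub> f [^]\<^bsub>G\<^esub> (- k))" (is "group_hom G G ?c")
    and "f [^]\<^bsub>G\<^esub> k \<otimes>\<^bsub>G\<^esub> f \<otimes>\<^bsub>G\<^esub> f [^]\<^bsub>G\<^esub> (- k) = f"
proof -
  interpret group G by fact
  have cancel: "f [^] (- k) \<otimes> (f [^] k \<otimes> z) = z" if "z \<in> carrier G" for z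
    using assms(2) that by (simp flip: m_assoc int_pow_mult)
  show "group_hom G G ?c"
    by (intro group_hom.intro group_hom_axioms.intro homI \<open>group G\<close>)
      (use assms(2) cancel in \<open>simp_all add: m_assoc\<close>)
  have "f [^] k \<otimes> f [^] (1::int) \<otimes> f [^] (- k) = f [^] (k + 1 + - k)"
    using assms(2) by (simp only: int_pow_mult)
  then show "f [^] k \<otimes> f \<otimes> f [^] (- k) = f" using assms(2) by simp
qed

text \<open>
  A relation \<open>w(f, g) = 1\<close> passes to the conjugates by powers of \<open>f\<close>, since these fix \<open>f\<close>. The set of
  \<open>u\<close> with \<open>w(f, u) x = w(f, h) x\<close> is an open neighbourhood of \<open>h\<close>, so it contains such a conjugate, and
  \<open>w(f, h)\<close> fixes each point \<open>x\<close>.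
\<close>

lemma dense_conjugates_no_relation:
  assumes f: "f \<in> order_auts S r" and g: "g \<in> order_auts S r"
    and dense: "dense_in (aut_topology S r)
      {f [^]\<^bsub>aut_group S r\<^esub> k \<otimes>\<^bsub>aut_group S r\<^esub> g \<otimes>\<^bsub>aut_group S r\<^esub> f [^]\<^bsub>aut_group S r\<^esub> (- k) | k :: int. True}"
    and h: "h \<in> order_auts S r" "word_eval (aut_group S r) f h w \<noteq> id"
  shows "word_eval (aut_group S r) f g w \<noteq> id"
proof
  let ?G = "aut_group S r"
  let ?c = "\<lambda>k::int. \<lambda>x. f [^]\<^bsub>?G\<^esub> k \<otimes>\<^bsub>?G\<^esub> x \<otimes>\<^bsub>?G\<^esub> f [^]\<^bsub>?G\<^esub> (- k)"
  assume g_id: "word_eval ?G f g w = id"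
  have "word_eval ?G f (?c k g) w = id" for k
  proof -
    have "word_eval ?G (?c k f) (?c k g) w = ?c k (word_eval ?G f g w)"
      using group_hom_word_eval[OF conj_int_pow_hom(1)[OF group_aut_group], of f S r f g k w] f g
      by simp
    also have "\<dots> = \<one>\<^bsub>?G\<^esub>"
      using g_id group_hom.hom_one[OF conj_int_pow_hom(1)[OF group_aut_group, of f S r k]] f by simp
    also have "?c k f = f" using conj_int_pow_hom(2)[OF group_aut_group, of f S r k] f by simp
    finally show ?thesis by (simp only: one_aut_group)
  qed
  note rel = this
  have in_G: "word_eval ?G f h w \<in> order_auts S r"
    using word_eval_closed[OF group_aut_group, of f S r h w] f h by simp
  obtain x where x: "x \<in> S" "word_eval ?G f h w x \<noteq> x"
    using h(2) permutes_not_in[OF order_auts_permutes[OF in_G]] by (metis eq_id_iff)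
  let ?y = "word_eval ?G f h w x"
  let ?U = "{u \<in> topspace (aut_topology S r). word_eval ?G f u w x = ?y}"
  have "continuous_map (aut_topology S r) (aut_topology S r) (\<lambda>u. word_eval ?G f u w)"
    using f by (intro continuous_map_word_eval) (simp_all add: continuous_map_const)
  then have U: "openin (aut_topology S r) ?U"
    using x(1) order_auts_in[OF in_G x(1)] unfolding continuous_map_aut_iff by blast
  have "h \<in> ?U" using h(1) by simp
  moreover have "h \<in> aut_topology S r closure_of {?c k g | k :: int. True}"
    using dense h(1) by (simp add: dense_in_def)
  ultimately have "\<exists>d. d \<in> {?c k g | k :: int. True} \<and> d \<in> ?U"
    using U by (intro in_closure_of[THEN iffD1, THEN conjunct2, rule_format]) auto
  then obtain k where "word_eval ?G f (?c k g) w x = ?y" by blast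
  then show False using rel[of k] x(2) by simp
qed

lemma XB_word_nontrivial:
  assumes f: "f \<in> XB" and w: "irreducible_word w"
  obtains h where "h \<in> AutB_set" "word_eval AutB f h w \<noteq> id"
proof -
  have fA: "f \<in> AutB_set" and tf: "no_finite_cycles (tau f)" using f by (simp_all add: XB_def)
  obtain s x where s: "s permutes {1..}" "word_eval Sym_pos (tau f) s w x \<noteq> x"
    using irreducible_word_escapes[OF tau_permutes[OF fA] tf w] by metis
  have h: "column_aut s (\<lambda>_. id) \<in> AutB_set" "tau (column_aut s (\<lambda>_. id)) = s"
    using column_aut[OF s(1), of "\<lambda>_. id"] by (simp_all add: order_auts_id)
  have "tau (word_eval AutB f (column_aut s (\<lambda>_. id)) w) = word_eval Sym_pos (tau f) s w"
    using group_hom_word_eval[OF group_hom_tau, of f "column_aut s (\<lambda>_. id)" w] fA h by simp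
  moreover have "tau id = id" using group_hom.hom_one[OF group_hom_tau] by simp
  ultimately have "word_eval AutB f (column_aut s (\<lambda>_. id)) w \<noteq> id" using s(2) by force
  then show thesis using that h(1) by blast
qed

lemma dense_conjugates_freely_generate_dense:
  assumes f: "f \<in> XB" and g: "g \<in> AutB_set"
    and dense: "dense_in AutB_top {conj_pow f k g | k :: int. True}"
  shows "freely_generate_dense AutB AutB_top f g"
proof -
  have fA: "f \<in> AutB_set" using f by (simp add: XB_def)
  interpret group AutB by (rule group_aut_group)
  have "word_eval AutB f g w \<noteq> \<one>\<^bsub>AutB\<^esub>" if w: "irreducible_word w" for w
    using XB_word_nontrivial[OF f w] dense_conjugates_no_relation[OF fA g dense] by (metis one_aut_group)
  moreover have "dense_in AutB_top (generate AutB {f, g})"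
  proof -
    have sub: "subgroup (generate AutB {f, g}) AutB"
      using fA g by (intro generate_is_subgroup) simp
    have gens: "f \<in> generate AutB {f, g}" "g \<in> generate AutB {f, g}"
      by (auto intro: generate.incl)
    have "conj_pow f k g \<in> generate AutB {f, g}" for k :: int
      by (intro subgroup.m_closed[OF sub] subgroup_int_pow_closed[OF sub] gens)
    then have "AutB_top closure_of {conj_pow f k g | k :: int. True} \<subseteq> AutB_top closure_of generate AutB {f, g}"
      by (intro closure_of_mono) blast
    moreover have "generate AutB {f, g} \<subseteq> topspace AutB_top"
      using subgroup.subset[OF sub] by simp
    ultimately show ?thesis
      using dense closure_of_subset_topspace[of AutB_top] unfolding dense_in_def by blast
  qed
  ultimately show ?thesis by (simp add: freely_generate_dense_def)
qed

section \<open>Generic conjugates\<close>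

text \<open>
  A pattern prescribes finitely many values of a tuple of automorphisms, as triples of an index, an
  argument and a value; it belongs to \<open>patterns I\<close> if some tuple has these values. The tuples
  following a pattern form a nonempty basic open set of the power with index set \<open>I\<close>. Coding the
  set by its pattern shows that there are only countably many for countable \<open>I\<close>.
\<close>

definition patterns :: "'i set \<Rightarrow> ('i \<times> (nat \<times> rat) \<times> (nat \<times> rat)) set set" where
  "patterns I = {P. finite P \<and> P \<subseteq> I \<times> Bw \<times> Bw \<and>
     (\<exists>q. (\<forall>i\<in>I. q i \<in> AutB_set) \<and> (\<forall>(i, x, y)\<in>P. q i x = y))}"

lemma patternsD:
  assumes "P \<in> patterns I" shows "finite P" "P \<subseteq> I \<times> Bw \<times> Bw"
  using assms by (simp_all add: patterns_def)

lemma countable_patterns: "countable (patterns (I :: 'i::countable set))"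
  by (rule countable_subset[OF _ countable_Collect_finite]) (auto simp: patterns_def)

text \<open>
  The families \<open>\<phi>\<close> and \<open>\<psi>\<close> cover both a varying \<open>f\<close> and a fixed one.
\<close>

lemma openin_conj_pow_pattern:
  assumes P: "P \<in> patterns I"
    and "continuous_map Y AutB_top \<phi>" "\<And>i. i \<in> I \<Longrightarrow> continuous_map Y AutB_top (\<psi> i)"
  shows "openin Y {u \<in> topspace Y. \<exists>k::int. \<forall>(i, x, y)\<in>P. conj_pow (\<phi> u) k (\<psi> i u) x = y}"
proof -
  have "openin Y ((\<Inter>(i, x, y)\<in>P. {u \<in> topspace Y. conj_pow (\<phi> u) k (\<psi> i u) x = y}) \<inter> topspace Y)" for k :: int
  proof (intro openin_INT patternsD(1)[OF P])
    fix p assume "p \<in> P"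
    then obtain i x y where p: "p = (i, x, y)" "i \<in> I" "x \<in> Bw" "y \<in> Bw" using patternsD(2)[OF P] by auto
    have "continuous_map Y AutB_top (\<lambda>u. conj_pow (\<phi> u) k (\<psi> i u))"
      unfolding mult_aut_group
      by (intro continuous_map_aut_comp continuous_map_aut_int_pow assms(2) assms(3)[OF p(2)])
    then show "openin Y (case p of (i, x, y) \<Rightarrow> {u \<in> topspace Y. conj_pow (\<phi> u) k (\<psi> i u) x = y})"
      using p(3,4) unfolding p(1) continuous_map_aut_iff by simp
  qed
  then have "openin Y (\<Union>k::int. (\<Inter>(i, x, y)\<in>P. {u \<in> topspace Y. conj_pow (\<phi> u) k (\<psi> i u) x = y}) \<inter> topspace Y)"
    by (intro openin_Union) auto
  also have "(\<Union>k::int. (\<Inter>(i, x, y)\<in>P. {u \<in> topspace Y. conj_pow (\<phi> u) k (\<psi> i u) x = y}) \<inter> topspace Y)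
    = {u \<in> topspace Y. \<exists>k::int. \<forall>(i, x, y)\<in>P. conj_pow (\<phi> u) k (\<psi> i u) x = y}"
    by auto
  finally show ?thesis .
qed

text \<open>
  The density step: near any tuple \<open>g\<close> there is one with a conjugate that follows the
  pattern, while \<open>f\<close> is left unchanged.
\<close>

lemma conj_pow_realises_pattern:
  assumes f: "f \<in> XB" and I: "finite I" and P: "P \<in> patterns I"
    and A: "finite A" "A \<subseteq> Bw" and g: "\<And>i. i \<in> I \<Longrightarrow> g i \<in> AutB_set"
  obtains g' k where "\<forall>i\<in>I. g' i \<in> AutB_set" "\<forall>i\<in>I. \<forall>x\<in>A. g' i x = g i x"
    "\<forall>(i, x, y)\<in>P. conj_pow f k (g' i) x = y"
proof -
  obtain q where q: "\<forall>i\<in>I. q i \<in> AutB_set" "\<forall>(i, x, y)\<in>P. q i x = y"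
    using P unfolding patterns_def by (elim CollectE exE conjE)
  define B where "B = A \<union> (\<lambda>(i, x, y). x) ` P"
  define K where "K = B \<union> (\<Union>i\<in>I. g i ` B) \<union> (\<Union>i\<in>I. q i ` B)"
  have B: "finite B" "B \<subseteq> Bw" using A patternsD[OF P] by (auto simp: B_def)
  have "finite K" using B(1) I by (simp add: K_def)
  moreover have "K \<subseteq> Bw"
    using B(2) order_auts_in[OF g] order_auts_in[OF bspec[OF q(1)]] unfolding K_def by blast
  ultimately obtain k :: int where k: "\<And>g q A. \<lbrakk>g \<in> AutB_set; q \<in> AutB_set; A \<subseteq> K; g ` A \<subseteq> K; q ` A \<subseteq> K\<rbrakk> \<Longrightarrow>
    \<exists>g'\<in>AutB_set. (\<forall>x\<in>A. g' x = g x) \<and> (\<forall>x\<in>A. conj_pow f k g' x = q x)"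
    using conj_pow_amalgamation[OF f] by blast
  have "\<forall>i\<in>I. \<exists>g'\<in>AutB_set. (\<forall>x\<in>B. g' x = g i x) \<and> (\<forall>x\<in>B. conj_pow f k g' x = q i x)"
  proof
    fix i assume i: "i \<in> I"
    show "\<exists>g'\<in>AutB_set. (\<forall>x\<in>B. g' x = g i x) \<and> (\<forall>x\<in>B. conj_pow f k g' x = q i x)"
      by (rule k[OF g[OF i] bspec[OF q(1) i]]) (use i in \<open>auto simp: K_def\<close>)
  qed
  then obtain g' where g': "\<forall>i\<in>I. g' i \<in> AutB_set \<and> (\<forall>x\<in>B. g' i x = g i x) \<and> (\<forall>x\<in>B. conj_pow f k (g' i) x = q i x)"
    by (metis (no_types, lifting))
  show thesis
  proof (rule that[of g' k])
    show "\<forall>(i, x, y)\<in>P. conj_pow f k (g' i) x = y"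
    proof (clarify)
      fix i x1 x2 y1 y2 assume p: "(i, (x1, x2), (y1, y2)) \<in> P"
      then have "i \<in> I" "(x1, x2) \<in> B" using patternsD(2)[OF P] by (force simp: B_def)+
      then show "conj_pow f k (g' i) (x1, x2) = (y1, y2)" using g' bspec[OF q(2) p] by simp
    qed
  qed (use g' in \<open>simp_all add: B_def\<close>)
qed

lemma graph_in_patterns:
  assumes "finite I" "finite A" "A \<subseteq> Bw" "\<And>i. i \<in> I \<Longrightarrow> q i \<in> AutB_set"
  shows "(\<lambda>(i, x). (i, x, q i x)) ` (I \<times> A) \<in> patterns I"
  unfolding patterns_def
proof (intro CollectI conjI exI[of _ q] ballI)
  show "finite ((\<lambda>(i, x). (i, x, q i x)) ` (I \<times> A))" using assms(1,2) by simp
  have "q i x \<in> Bw" if "i \<in> I" "x \<in> A" for i x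
    using order_auts_in[OF assms(4)] assms(3) that by blast
  then show "(\<lambda>(i, x). (i, x, q i x)) ` (I \<times> A) \<subseteq> I \<times> Bw \<times> Bw"
    using subsetD[OF assms(3)] by (intro image_subsetI) (simp add: split_beta mem_Times_iff)
qed (use assms(4) in \<open>auto simp del: split_paired_All\<close>)

lemma product_open_contains_cylinder:
  assumes I: "finite I" and U: "openin (product_topology (\<lambda>_. AutB_top) I) U" "u \<in> U"
  obtains A where "finite A" "A \<subseteq> Bw"
    "{v \<in> I \<rightarrow>\<^sub>E AutB_set. \<forall>i\<in>I. \<forall>x\<in>A. v i x = u i x} \<subseteq> U"
proof -
  obtain V where V: "\<And>i. i \<in> I \<Longrightarrow> openin AutB_top (V i)" "u \<in> PiE I V" "PiE I V \<subseteq> U"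
    using U unfolding openin_product_topology_alt by metis
  have "\<forall>i\<in>I. \<exists>A. finite A \<and> A \<subseteq> Bw \<and> {h \<in> AutB_set. \<forall>x\<in>A. h x = u i x} \<subseteq> V i"
  proof
    fix i assume "i \<in> I"
    then have "openin AutB_top (V i)" "u i \<in> V i" using V by auto
    then show "\<exists>A. finite A \<and> A \<subseteq> Bw \<and> {h \<in> AutB_set. \<forall>x\<in>A. h x = u i x} \<subseteq> V i"
      by (rule aut_open_contains_cylinder) blast
  qed
  from bchoice[OF this] obtain A where
    A: "\<forall>i\<in>I. finite (A i) \<and> A i \<subseteq> Bw \<and> {h \<in> AutB_set. \<forall>x\<in>A i. h x = u i x} \<subseteq> V i" ..
  show thesis
  proof (rule that[of "\<Union>i\<in>I. A i"])
    show "{v \<in> I \<rightarrow>\<^sub>E AutB_set. \<forall>i\<in>I. \<forall>x\<in>\<Union>i\<in>I. A i. v i x = u i x} \<subseteq> U"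
    proof
      fix v assume "v \<in> {v \<in> I \<rightarrow>\<^sub>E AutB_set. \<forall>i\<in>I. \<forall>x\<in>\<Union>i\<in>I. A i. v i x = u i x}"
      then have v: "v \<in> I \<rightarrow>\<^sub>E AutB_set" "\<forall>i\<in>I. \<forall>x\<in>A i. v i x = u i x" by blast+
      have "v i \<in> V i" if i: "i \<in> I" for i
        using A v(2) PiE_mem[OF v(1) i] i by blast
      moreover have "v \<in> extensional I" using v(1) by (simp add: PiE_def)
      ultimately have "v \<in> PiE I V" by (simp add: PiE_iff)
      then show "v \<in> U" using V(3) by blast
    qed
  qed (use A I in blast)+
qed

lemma dense_conj_pow_tuple:
  assumes I: "finite I" and f: "f \<in> AutB_set" and g: "\<And>i. i \<in> I \<Longrightarrow> g i \<in> AutB_set"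
    and pat: "\<And>P. P \<in> patterns I \<Longrightarrow> \<exists>k::int. \<forall>(i, x, y)\<in>P. conj_pow f k (g i) x = y"
  shows "dense_in (product_topology (\<lambda>_. AutB_top) I) {\<lambda>i\<in>I. conj_pow f k (g i) | k :: int. True}"
proof (rule dense_inI)
  have conj: "conj_pow f k (g i) \<in> AutB_set" if "i \<in> I" for k :: int and i
    using f g[OF that] by (simp add: order_auts_comp aut_int_pow_in)
  then show "{\<lambda>i\<in>I. conj_pow f k (g i) | k :: int. True} \<subseteq> topspace (product_topology (\<lambda>_. AutB_top) I)"
    by auto
  fix U u assume U: "openin (product_topology (\<lambda>_. AutB_top) I) U" "u \<in> U"
  obtain A where A: "finite A" "A \<subseteq> Bw"
    "{v \<in> I \<rightarrow>\<^sub>E AutB_set. \<forall>i\<in>I. \<forall>x\<in>A. v i x = u i x} \<subseteq> U"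
    by (rule product_open_contains_cylinder[OF I U])
  have "u \<in> I \<rightarrow>\<^sub>E AutB_set" using openin_subset[OF U(1)] U(2) by auto
  then have "u i \<in> AutB_set" if "i \<in> I" for i using that by auto
  then obtain k :: int where "\<forall>(i, x, y)\<in>(\<lambda>(i, x). (i, x, u i x)) ` (I \<times> A). conj_pow f k (g i) x = y"
    using pat[OF graph_in_patterns[OF I A(1,2), of u]] by blast
  then have k: "conj_pow f k (g i) x = u i x" if "i \<in> I" "x \<in> A" for i x using that by force
  have "(\<lambda>i\<in>I. conj_pow f k (g i)) \<in> {v \<in> I \<rightarrow>\<^sub>E AutB_set. \<forall>i\<in>I. \<forall>x\<in>A. v i x = u i x}"
    using k conj by (simp del: split_paired_All)
  then have "(\<lambda>i\<in>I. conj_pow f k (g i)) \<in> U" using A(3) by blast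
  then show "\<exists>d\<in>{\<lambda>i\<in>I. conj_pow f k (g i) | k :: int. True}. d \<in> U" by blast
qed

lemma dense_conj_pow:
  assumes f: "f \<in> AutB_set" and g: "g \<in> AutB_set"
    and pat: "\<And>P. P \<in> patterns {()} \<Longrightarrow> \<exists>k::int. \<forall>(i, x, y)\<in>P. conj_pow f k g x = y"
  shows "dense_in AutB_top {conj_pow f k g | k :: int. True}"
proof (rule dense_inI)
  show "{conj_pow f k g | k :: int. True} \<subseteq> topspace AutB_top"
    using f g by (auto simp: order_auts_comp aut_int_pow_in)
  fix U u assume U: "openin AutB_top U" "u \<in> U"
  obtain A where A: "finite A" "A \<subseteq> Bw" "{h \<in> AutB_set. \<forall>x\<in>A. h x = u x} \<subseteq> U"
    using aut_open_contains_cylinder[OF U] by blast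
  have "u \<in> AutB_set" using openin_subset[OF U(1)] U(2) by auto
  then obtain k :: int where "\<forall>(i, x, y)\<in>(\<lambda>(i, x). (i, x, u x)) ` ({()} \<times> A). conj_pow f k g x = y"
    using pat[OF graph_in_patterns[OF _ A(1,2), of "{()}" "\<lambda>_. u"]] by auto
  then have "\<forall>x\<in>A. conj_pow f k g x = u x" by force
  moreover have "conj_pow f k g \<in> AutB_set" using f g by (simp add: order_auts_comp aut_int_pow_in)
  ultimately have "conj_pow f k g \<in> U" using A(3) by blast
  then show "\<exists>d\<in>{conj_pow f k g | k :: int. True}. d \<in> U" by blast
qed

text \<open>
  To reach a given open dense set from \<open>(f, g)\<close>, it suffices to change \<open>g\<close> and to keep \<open>f\<close>. A
  single automorphism is treated as a tuple indexed by the unit type.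
\<close>

lemma comeager_freely_generate_dense:
  "comeager_in (prod_topology (subtopology AutB_top XB) AutB_top)
     {(f, g). f \<in> XB \<and> g \<in> carrier AutB \<and> freely_generate_dense AutB AutB_top f g}"
proof -
  let ?T = "prod_topology (subtopology AutB_top XB) AutB_top"
  have XB_sub: "XB \<subseteq> AutB_set" by (auto simp: XB_def)
  then have top: "topspace ?T = XB \<times> AutB_set" by auto
  define hits where "hits P = {u \<in> topspace ?T. \<exists>k::int. \<forall>(i::unit, x, y)\<in>P. conj_pow (fst u) k (snd u) x = y}" for P
  show ?thesis
  proof (rule comeager_inI[where \<U> = "hits ` patterns {()}"])
    show "countable (hits ` patterns {()})" by (intro countable_image countable_patterns)
    show "openin ?T U" if U: "U \<in> hits ` patterns {()}" for U
    proof -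
      obtain P where P: "U = hits P" "P \<in> patterns {()}" using U by blast
      have "continuous_map ?T AutB_top fst"
        using continuous_map_fst continuous_map_into_fulltopology by blast
      then show ?thesis
        using openin_conj_pow_pattern[OF P(2), of ?T fst "\<lambda>_. snd"] continuous_map_snd
        unfolding P(1) hits_def by blast
    qed
    show "U \<inter> W \<noteq> {}" if U: "U \<in> hits ` patterns {()}" and W: "openin ?T W" "W \<noteq> {}" for U W
    proof -
      obtain P where P: "U = hits P" "P \<in> patterns {()}" using U by blast
      obtain f g where fg: "(f, g) \<in> W" using W(2) by auto
      then have f: "f \<in> XB" and g: "g \<in> AutB_set" using openin_subset[OF W(1)] top by auto
      obtain V1 V2 where V: "openin (subtopology AutB_top XB) V1" "openin AutB_top V2"
        "f \<in> V1" "g \<in> V2" "V1 \<times> V2 \<subseteq> W"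
        using W(1) fg unfolding openin_prod_topology_alt by meson
      obtain A where A: "finite A" "A \<subseteq> Bw" "{h \<in> AutB_set. \<forall>x\<in>A. h x = g x} \<subseteq> V2"
        using aut_open_contains_cylinder[OF V(2,4)] by blast
      obtain g' k where g': "\<forall>i\<in>{()}. g' i \<in> AutB_set" "\<forall>i\<in>{()}. \<forall>x\<in>A. g' i x = g x"
        "\<forall>(i, x, y)\<in>P. conj_pow f k (g' i) x = y"
        by (rule conj_pow_realises_pattern[OF f _ P(2) A(1,2), of "\<lambda>_. g"]) (use g in auto)
      have "g' () \<in> V2" using A(3) g'(1,2) by blast
      then have "(f, g' ()) \<in> W" using V by blast
      moreover have "(f, g' ()) \<in> U"
        using g' f top unfolding P(1) hits_def by auto
      ultimately show ?thesis by blast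
    qed
    show "topspace ?T \<inter> \<Inter> (hits ` patterns {()})
      \<subseteq> {(f, g). f \<in> XB \<and> g \<in> carrier AutB \<and> freely_generate_dense AutB AutB_top f g}"
    proof (clarify)
      fix f g assume "(f, g) \<in> topspace ?T" and all: "(f, g) \<in> \<Inter> (hits ` patterns {()})"
      then have f: "f \<in> XB" and g: "g \<in> AutB_set" using top by auto
      have "dense_in AutB_top {conj_pow f k g | k :: int. True}"
        by (rule dense_conj_pow) (use f g XB_sub all in \<open>auto simp: hits_def\<close>)
      then show "f \<in> XB \<and> g \<in> carrier AutB \<and> freely_generate_dense AutB AutB_top f g"
        using f g dense_conjugates_freely_generate_dense by simp
    qed
  qed (use XB_sub in auto)
qed

text \<open>
  One \<open>f\<close> without finite cycles witnesses cyclic density for a comeager set of tuples.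
\<close>

lemma comeager_cyclically_dense:
  assumes f: "f \<in> XB"
  shows "comeager_in (product_topology (\<lambda>_. AutB_top) {1..m}) {g. cyclically_dense AutB AutB_top m g}"
proof -
  let ?I = "{1..m}"
  let ?T = "product_topology (\<lambda>_. AutB_top) ?I"
  have fA: "f \<in> AutB_set" using f by (simp add: XB_def)
  have top: "topspace ?T = ?I \<rightarrow>\<^sub>E AutB_set" by simp
  define hits where "hits P = {u \<in> topspace ?T. \<exists>k::int. \<forall>(i, x, y)\<in>P. conj_pow f k (u i) x = y}" for P
  show ?thesis
  proof (rule comeager_inI[where \<U> = "hits ` patterns ?I"])
    show "{g. cyclically_dense AutB AutB_top m g} \<subseteq> topspace ?T"
      by (auto simp: cyclically_dense_def)
    show "countable (hits ` patterns ?I)" by (intro countable_image countable_patterns)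
    show "openin ?T U" if U: "U \<in> hits ` patterns ?I" for U
    proof -
      obtain P where P: "U = hits P" "P \<in> patterns ?I" using U by blast
      have "continuous_map ?T AutB_top (\<lambda>u. f)" using fA by (simp add: continuous_map_const)
      moreover have "continuous_map ?T AutB_top (\<lambda>u. u i)" if "i \<in> ?I" for i
        using continuous_map_product_projection[OF that, of "\<lambda>_. AutB_top"] .
      ultimately show ?thesis
        using openin_conj_pow_pattern[OF P(2), of ?T "\<lambda>_. f" "\<lambda>i u. u i"]
        unfolding P(1) hits_def by blast
    qed
    show "U \<inter> W \<noteq> {}" if U: "U \<in> hits ` patterns ?I" and W: "openin ?T W" "W \<noteq> {}" for U W
    proof -
      obtain P where P: "U = hits P" "P \<in> patterns ?I" using U by blast
      obtain g where gW: "g \<in> W" using W(2) by auto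
      then have g: "g \<in> ?I \<rightarrow>\<^sub>E AutB_set" using openin_subset[OF W(1)] top by blast
      obtain A where A: "finite A" "A \<subseteq> Bw"
        "{v \<in> ?I \<rightarrow>\<^sub>E AutB_set. \<forall>i\<in>?I. \<forall>x\<in>A. v i x = g i x} \<subseteq> W"
        by (rule product_open_contains_cylinder[OF finite_atLeastAtMost W(1) gW])
      obtain g' k where g': "\<forall>i\<in>?I. g' i \<in> AutB_set" "\<forall>i\<in>?I. \<forall>x\<in>A. g' i x = g i x"
        "\<forall>(i, x, y)\<in>P. conj_pow f k (g' i) x = y"
        by (rule conj_pow_realises_pattern[OF f finite_atLeastAtMost P(2) A(1,2), of g]) (use PiE_mem[OF g] in auto)
      define v where "v = restrict g' ?I"
      have v: "v \<in> ?I \<rightarrow>\<^sub>E AutB_set" using g'(1) by (auto simp: v_def)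
      moreover have "\<forall>i\<in>?I. \<forall>x\<in>A. v i x = g i x" using g'(2) by (simp add: v_def)
      ultimately have "v \<in> W" using A(3) by blast
      moreover have "\<forall>(i, x, y)\<in>P. conj_pow f k (v i) x = y"
        using g'(3) patternsD(2)[OF P(2)] by (fastforce simp: v_def)
      then have "v \<in> U" unfolding P(1) hits_def using v top by blast
      ultimately show ?thesis by blast
    qed
    show "topspace ?T \<inter> \<Inter> (hits ` patterns ?I) \<subseteq> {g. cyclically_dense AutB AutB_top m g}"
    proof
      fix g assume g_all: "g \<in> topspace ?T \<inter> \<Inter> (hits ` patterns ?I)"
      then have g: "g \<in> ?I \<rightarrow>\<^sub>E AutB_set" using top by blast
      have "dense_in ?T {\<lambda>i\<in>?I. conj_pow f k (g i) | k :: int. True}"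
      proof (rule dense_conj_pow_tuple[OF finite_atLeastAtMost fA PiE_mem[OF g]])
        fix P assume "P \<in> patterns ?I"
        then have "g \<in> hits P" using g_all by blast
        then show "\<exists>k::int. \<forall>(i, x, y)\<in>P. conj_pow f k (g i) x = y" unfolding hits_def by blast
      qed
      then show "g \<in> {g. cyclically_dense AutB AutB_top m g}"
        using g fA unfolding cyclically_dense_def carrier_aut_group by blast
    qed
  qed
qed

theorem corollary4p8:
  shows "comeager_in (prod_topology (subtopology AutB_top XB) AutB_top)
           {(f, g). f \<in> XB \<and> g \<in> carrier AutB \<and> freely_generate_dense AutB AutB_top f g}
       \<and> (\<forall>m\<ge>1. comeager_in (product_topology (\<lambda>_. AutB_top) {1..m})
           {g. cyclically_dense AutB AutB_top m g})"
  using comeager_freely_generate_dense comeager_cyclically_dense XB_nonempty by blast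

end
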